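(* Let $U=ae_r+be_\theta+ce_z$ be an axisymmetric solution of the Euler equation on the solid torus $M$ with pressure $P$ and initial velocity $U_0=a_0e_r+b_0e_\theta+c_0e_z$. Suppose $c_0$ is odd in $z$ and $a_0$ is even in $z$, with $b_0$ either even or odd in $z$. Assume that $P_{zz}(0,1,0)<0$, that $c_z(0,1,0)<0$, and that $c_z(0,1,0)^2+P_{zz}(0,1,0)>0$ (arguments are $(t,r,z)$). If $P_{zz}(t,1,0)$ is increasing in $t$ for all time, then the solution ends in finite time. The same is true if $(t,1,0)$ is replaced everywhere with $(t,0,0)$ (i.e. if all quantities are evaluated at $r=0$, $z=0$ instead of $r=1$, $z=0$).
   Context: Configuration domain: $M=\{(x,y,z): x^2+y^2\le 1,\ -\pi\le z\le \pi\}/\{(x,y,-\pi)\equiv(x,y,\pi)\}$ with the flat metric and cylindrical coordinates $(r,\theta,z)$; $e_r,e_\theta,e_z$ are the usual cylindrical unit vector fields. An axisymmetric velocity field is $U=ae_r+be_\theta+ce_z$ with $a,b,c$ functions of $(t,r,z)$ only; $U$ is tangent to $\partial M$ (i.e. $a=0$ at $r=1$). The Euler equation is $U_t+U\cdot\nabla U=-\nabla P$, $\operatorname{div}U=0$, $U|_{t=0}=U_0$, where the axisymmetric pressure $P=P(t,r,z)$ is determined (up to a function of time) by $\Delta P=-\operatorname{Tr}((\nabla U)^2)$ with $\langle\nabla P,e_r\rangle=-\langle U\cdot\nabla U,e_r\rangle$ at $r=1$. Solutions are assumed smooth on their maximal interval of existence. Odd/even in $z$ refers to the reflection $z\mapsto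 -z$ of $z\in[-\pi,\pi]$. Subscripts $r,z,t$ denote partial derivatives. "For all time" means for all $t\ge0$ in the interval of existence, and "the solution ends in finite time" means that the maximal time of existence of the smooth solution is finite. *)

theory Defs
  imports "HOL-Analysis.Analysis"
begin

text \<open>
  Functions of class C^k on a set that need not be open, by means of derivatives relative to the
  set. It is used only for convex sets with nonempty interior, on which these derivatives are
  unique; there it amounts to all partial derivatives up to order \<open>k\<close> existing in the interior
  and extending continuously to the whole set. The function \<open>g i\<close> is the partial derivative in
  direction \<open>i\<close>.
\<close>

primrec Ck_on :: "nat \<Rightarrow> 'a::euclidean_space set \<Rightarrow> ('a \<Rightarrow> 'b::real_normed_vector) \<Rightarrow> bool" where
  "Ck_on 0 S f \<longleftrightarrow> continuous_on S f"
| "Ck_on (Suc k) S f \<longleftrightarrow>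
     (\<exists>g. (\<forall>x\<in>S. (f has_derivative (\<lambda>h. \<Sum>i\<in>Basis. (h \<bullet> i) *\<^sub>R g i x)) (at x within S)) \<and>
          (\<forall>i\<in>Basis. Ck_on k S (g i)))"

definition smooth_on :: "'a::euclidean_space set \<Rightarrow> ('a \<Rightarrow> 'b::real_normed_vector) \<Rightarrow> bool" where
  "smooth_on S f \<longleftrightarrow> (\<forall>k. Ck_on k S f)"

text \<open>
  The solid torus is the quotient of the infinite solid cylinder by the translation
  \<open>z \<mapsto> z + 2 * pi\<close>. Functions and vector fields on it are represented by their
  periodic lifts to the cylinder; values outside the cylinder are irrelevant.
\<close>

definition cylinder :: "(real ^ 3) set" where
  "cylinder = {x. (x $ 1)\<^sup>2 + (x $ 2)\<^sup>2 \<le> 1}"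

definition z_periodic :: "(real ^ 3 \<Rightarrow> 'b) \<Rightarrow> bool" where
  "z_periodic f \<longleftrightarrow> (\<forall>x\<in>cylinder. f (x + vector [0, 0, 2 * pi]) = f x)"

definition cyl_point :: "real \<Rightarrow> real \<Rightarrow> real \<Rightarrow> real ^ 3" where
  "cyl_point r \<theta> z = vector [r * cos \<theta>, r * sin \<theta>, z]"

definition e_r :: "real \<Rightarrow> real ^ 3" where
  "e_r \<theta> = vector [cos \<theta>, sin \<theta>, 0]"

definition e_theta :: "real \<Rightarrow> real ^ 3" where
  "e_theta \<theta> = vector [- sin \<theta>, cos \<theta>, 0]"

definition e_z :: "real ^ 3" where
  "e_z = vector [0, 0, 1]"

text \<open>
  At \<open>r = 0\<close> the condition for all \<open>\<theta>\<close> forces \<open>a 0 z = b 0 z = 0\<close>.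
\<close>

definition axisymmetric_field ::
  "(real ^ 3 \<Rightarrow> real ^ 3) \<Rightarrow> (real \<Rightarrow> real \<Rightarrow> real) \<Rightarrow> (real \<Rightarrow> real \<Rightarrow> real) \<Rightarrow> (real \<Rightarrow> real \<Rightarrow> real) \<Rightarrow> bool"
where
  "axisymmetric_field V a b c \<longleftrightarrow>
     (\<forall>r\<in>{0..1}. \<forall>\<theta> z.
        V (cyl_point r \<theta> z) = a r z *\<^sub>R e_r \<theta> + b r z *\<^sub>R e_theta \<theta> + c r z *\<^sub>R e_z)"

definition axisymmetric_function :: "(real ^ 3 \<Rightarrow> real) \<Rightarrow> (real \<Rightarrow> real \<Rightarrow> real) \<Rightarrow> bool" where
  "axisymmetric_function f F \<longleftrightarrow> (\<forall>r\<in>{0..1}. \<forall>\<theta> z. f (cyl_point r \<theta> z) = F r z)"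

definition even_in_z :: "(real \<Rightarrow> real \<Rightarrow> real) \<Rightarrow> bool" where
  "even_in_z f \<longleftrightarrow> (\<forall>r\<in>{0..1}. \<forall>z\<in>{-pi..pi}. f r (- z) = f r z)"

definition odd_in_z :: "(real \<Rightarrow> real \<Rightarrow> real) \<Rightarrow> bool" where
  "odd_in_z f \<longleftrightarrow> (\<forall>r\<in>{0..1}. \<forall>z\<in>{-pi..pi}. f r (- z) = - f r z)"

definition grad :: "(real ^ 3 \<Rightarrow> real) \<Rightarrow> real ^ 3 \<Rightarrow> real ^ 3" where
  "grad f x = (\<chi> i. frechet_derivative f (at x within cylinder) (axis i 1))"

definition nabla :: "(real ^ 3 \<Rightarrow> real ^ 3) \<Rightarrow> real ^ 3 \<Rightarrow> real ^ 3 ^ 3" where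
  "nabla V x = jacobian V (at x within cylinder)"

definition divergence :: "(real ^ 3 \<Rightarrow> real ^ 3) \<Rightarrow> real ^ 3 \<Rightarrow> real" where
  "divergence V x = trace (nabla V x)"

definition times_before :: "ereal \<Rightarrow> real set" where
  "times_before T = {t. 0 \<le> t \<and> ereal t < T}"

text \<open>
  Smooth solutions of the Euler initial value problem on the time interval \<open>[0, T)\<close>. The
  pressure is only required to be smooth in space, since it is determined only up to an arbitrary
  function of time. Its Poisson equation and Neumann boundary condition follow by taking the
  divergence and the normal component of the momentum equation.
\<close>

definition euler_solution ::
  "(real ^ 3 \<Rightarrow> real ^ 3) \<Rightarrow> ereal \<Rightarrow> (real \<Rightarrow> real ^ 3 \<Rightarrow> real ^ 3) \<Rightarrow> (real \<Rightarrow> real ^ 3 \<Rightarrow> real) \<Rightarrow> bool"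
where
  "euler_solution U0 T U p \<longleftrightarrow>
     0 < T \<and>
     smooth_on (times_before T \<times> cylinder) (\<lambda>(t, x). U t x) \<and>
     (\<forall>t\<in>times_before T. smooth_on cylinder (p t)) \<and>
     (\<forall>t\<in>times_before T. z_periodic (U t) \<and> z_periodic (p t)) \<and>
     (\<forall>t\<in>times_before T. \<forall>x\<in>cylinder.
        ((\<lambda>s. U s x) has_vector_derivative (- grad (p t) x - nabla (U t) x *v U t x))
          (at t within times_before T)) \<and>
     (\<forall>t\<in>times_before T. \<forall>x\<in>cylinder. divergence (U t) x = 0) \<and>
     (\<forall>t\<in>times_before T. \<forall>\<theta> z. U t (cyl_point 1 \<theta> z) \<bullet> e_r \<theta> = 0) \<and>
     (\<forall>x\<in>cylinder. U 0 x = U0 x)"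

text \<open>
  \<open>[0, T)\<close> is the maximal interval of existence: the solution cannot be continued smoothly
  to a longer interval.
\<close>

definition maximal_euler_solution ::
  "(real ^ 3 \<Rightarrow> real ^ 3) \<Rightarrow> ereal \<Rightarrow> (real \<Rightarrow> real ^ 3 \<Rightarrow> real ^ 3) \<Rightarrow> (real \<Rightarrow> real ^ 3 \<Rightarrow> real) \<Rightarrow> bool"
where
  "maximal_euler_solution U0 T U p \<longleftrightarrow>
     euler_solution U0 T U p \<and>
     \<not> (\<exists>T' U' p'. T < T' \<and> euler_solution U0 T' U' p' \<and>
          (\<forall>t\<in>times_before T. \<forall>x\<in>cylinder. U' t x = U t x))"

end

theory Submission
  imports Defs
begin

text \<open>
  Reflecting the solution in the plane \<open>z = 0\<close> (if \<open>b\<^sub>0\<close> is even), or turning it by \<open>pi\<close> about a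
  horizontal axis (if \<open>b\<^sub>0\<close> is odd), gives an axisymmetric solution with the same initial data. An energy
  estimate shows that the two agree, so \<open>c\<close> vanishes for \<open>z = 0\<close>. At \<open>r = 0\<close> and at \<open>r = 1\<close> the \<open>z\<close>-component of
  the Euler equation reduces to \<open>c\<^sub>t + c c\<^sub>z = - P\<^sub>z\<close>; differentiating it in \<open>z\<close> shows that \<open>w = c\<^sub>z\<close> at \<open>z = 0\<close> solves
  the Riccati equation \<open>w' = - w\<^sup>2 - P\<^sub>z\<^sub>z\<close>. As \<open>P\<^sub>z\<^sub>z\<close> is increasing, \<open>w' \<le> k\<^sup>2 - w\<^sup>2\<close> with \<open>- k\<^sup>2\<close> the initial value of
  \<open>P\<^sub>z\<^sub>z\<close>, and \<open>w < - k\<close> initially, which drives \<open>w\<close> to minus infinity in finite time.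
\<close>

subsection \<open>Real and differential calculus\<close>

lemma continuous_on_case_prod:
  assumes "continuous_on S (\<lambda>(x, y). f x y)" "continuous_on A g" "continuous_on A h"
    and "\<And>x. x \<in> A \<Longrightarrow> (g x, h x) \<in> S"
  shows "continuous_on A (\<lambda>x. f (g x) (h x))"
  using continuous_on_compose2[OF assms(1) continuous_on_Pair[OF assms(2,3)]] assms(4) by auto

lemma mvt_real_Icc:
  fixes f f' :: "real \<Rightarrow> real"
  assumes "a \<le> b" "\<And>x. x \<in> {a..b} \<Longrightarrow> (f has_real_derivative f' x) (at x within {a..b})"
  shows "\<exists>x\<in>{a..b}. f b - f a = f' x * (b - a)"
  using mvt_very_simple[OF assms(1), of f "\<lambda>x h. f' x * h"] assms(2)
  by (simp add: has_field_derivative_def)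

lemma gronwall_inequality:
  fixes f f' \<phi> :: "real \<Rightarrow> real"
  assumes "a \<le> b"
    and f: "\<And>s. s \<in> {a..b} \<Longrightarrow> (f has_real_derivative f' s) (at s within {a..b})"
    and \<phi>: "continuous_on {a..b} \<phi>"
    and le: "\<And>s. s \<in> {a..b} \<Longrightarrow> f' s \<le> \<phi> s * f s"
  shows "f b \<le> f a * exp (integral {a..b} \<phi>)"
proof -
  define \<Phi> where "\<Phi> u = integral {a..u} \<phi>" for u
  define g where "g u = f u * exp (- \<Phi> u)" for u
  have \<Phi>: "(\<Phi> has_real_derivative \<phi> s) (at s within {a..b})" if "s \<in> {a..b}" for s
    unfolding \<Phi>_def using integral_has_real_derivative[OF \<phi> that] .
  have g: "(g has_real_derivative (f' s - \<phi> s * f s) * exp (- \<Phi> s)) (at s within {a..b})"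
    if "s \<in> {a..b}" for s
    unfolding g_def
    by (rule derivative_eq_intros f[OF that] \<Phi>[OF that] refl)+ (simp add: algebra_simps)
  obtain s where s: "s \<in> {a..b}" "g b - g a = (f' s - \<phi> s * f s) * exp (- \<Phi> s) * (b - a)"
    using mvt_real_Icc[OF \<open>a \<le> b\<close> g] by auto
  have "g b - g a \<le> 0"
    unfolding s(2) using le[OF s(1)] \<open>a \<le> b\<close> by (intro mult_nonpos_nonneg) auto
  then have "f b * exp (- \<Phi> b) \<le> f a"
    by (simp add: g_def \<Phi>_def)
  then have "f b * exp (- \<Phi> b) * exp (\<Phi> b) \<le> f a * exp (\<Phi> b)"
    by (intro mult_right_mono) auto
  then show ?thesis
    by (simp add: \<Phi>_def mult.assoc flip: exp_add)
qed

text \<open>Below \<open>-k\<close> the solution stays there by Gronwall applied to \<open>w + k\<close>, and then \<open>1 / w\<close> grows at least linearly.\<close>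

lemma riccati_no_global_solution:
  fixes w w' :: "real \<Rightarrow> real"
  assumes w: "\<And>t. t \<ge> 0 \<Longrightarrow> (w has_real_derivative w' t) (at t within {0..})"
    and le: "\<And>t. t \<ge> 0 \<Longrightarrow> w' t \<le> k\<^sup>2 - (w t)\<^sup>2"
    and k: "k > 0" "w 0 < - k"
  shows False
proof -
  have w_Icc: "(w has_real_derivative w' s) (at s within {0..t})" if "s \<in> {0..t}" for s t
    using w[of s] that by (auto intro: DERIV_subset)
  have below: "w t < - k" if "t \<ge> 0" for t
  proof -
    have "w t + k \<le> (w 0 + k) * exp (integral {0..t} (\<lambda>s. - (w s - k)))"
    proof (rule gronwall_inequality[OF that])
      show "((\<lambda>t. w t + k) has_real_derivative w' s) (at s within {0..t})" if "s \<in> {0..t}" for s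
        using w_Icc[OF that] by (auto intro!: derivative_eq_intros)
      show "continuous_on {0..t} (\<lambda>s. - (w s - k))"
        using DERIV_continuous_on[OF w_Icc] by (intro continuous_intros)
      show "w' s \<le> - (w s - k) * (w s + k)" if "s \<in> {0..t}" for s
        using le[of s] that by (simp add: algebra_simps power2_eq_square)
    qed
    also have "\<dots> < 0"
      using k by (intro mult_neg_pos) auto
    finally show ?thesis by simp
  qed
  have decr: "w t \<le> w 0" if "t \<ge> 0" for t
  proof -
    obtain s where s: "s \<in> {0..t}" "w t - w 0 = w' s * (t - 0)"
      using mvt_real_Icc[OF \<open>t \<ge> 0\<close> w_Icc] by auto
    have "k\<^sup>2 \<le> (w s)\<^sup>2"
      using below[of s] s(1) k abs_le_square_iff[of k "w s"] by auto
    then have "w' s \<le> 0"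
      using le[of s] s(1) by auto
    then have "w' s * (t - 0) \<le> 0"
      using that by (simp add: mult_nonpos_nonneg)
    with s(2) show ?thesis by simp
  qed
  define \<epsilon> where "\<epsilon> = 1 - k\<^sup>2 / (w 0)\<^sup>2"
  have "k\<^sup>2 < (w 0)\<^sup>2"
    using k by (smt (verit) power2_minus power_strict_mono zero_less_numeral)
  then have \<epsilon>: "\<epsilon> > 0"
    unfolding \<epsilon>_def using k by (simp add: field_simps)
  define t where "t = - 2 / (\<epsilon> * w 0)"
  have t: "t > 0"
    unfolding t_def using \<epsilon> k by (simp add: divide_neg_neg mult_pos_neg)
  have inv: "((\<lambda>s. 1 / w s) has_real_derivative - w' s / (w s)\<^sup>2) (at s within {0..t})"
    if "s \<in> {0..t}" for s
    using below[of s] k that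
    by (auto intro!: derivative_eq_intros w_Icc simp: power2_eq_square)
  obtain s where s: "s \<in> {0..t}" "1 / w t - 1 / w 0 = - w' s / (w s)\<^sup>2 * (t - 0)"
    using mvt_real_Icc[OF less_imp_le[OF t] inv] by auto
  have ws: "w s \<le> w 0" "w s < 0" "w 0 < 0"
    using decr[of s] below[of s] s(1) k by auto
  have "(w 0)\<^sup>2 \<le> (w s)\<^sup>2"
    using ws abs_le_square_iff[of "w 0" "w s"] by auto
  then have "k\<^sup>2 / (w s)\<^sup>2 \<le> k\<^sup>2 / (w 0)\<^sup>2"
    using ws by (intro divide_left_mono) auto
  moreover have "((w s)\<^sup>2 - k\<^sup>2) / (w s)\<^sup>2 \<le> - w' s / (w s)\<^sup>2"
    using le[of s] s(1) by (intro divide_right_mono) auto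
  moreover have "((w s)\<^sup>2 - k\<^sup>2) / (w s)\<^sup>2 = 1 - k\<^sup>2 / (w s)\<^sup>2"
    using ws by (simp add: diff_divide_distrib)
  ultimately have "\<epsilon> \<le> - w' s / (w s)\<^sup>2"
    unfolding \<epsilon>_def by linarith
  then have "\<epsilon> * t \<le> 1 / w t - 1 / w 0"
    unfolding s(2) using mult_right_mono[of \<epsilon> "- w' s / (w s)\<^sup>2" t] t by simp
  moreover have "\<epsilon> * t = - 2 / w 0"
    unfolding t_def using \<epsilon> by simp
  ultimately have "- 1 / w 0 \<le> 1 / w t"
    by (simp add: field_simps)
  moreover have "1 / w t < 0" "- 1 / w 0 > 0"
    using below[of t] t k ws by (auto simp: divide_pos_neg divide_neg_neg)
  ultimately show False by linarith
qed

lemma has_derivative_unique_convex: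
  fixes f :: "'a::euclidean_space \<Rightarrow> 'b::real_normed_vector"
  assumes S: "convex S" "interior S \<noteq> {}" "x \<in> S"
    and D: "(f has_derivative D) (at x within S)"
    and D': "(f has_derivative D') (at x within S)"
  shows "D = D'"
proof -
  interpret D: bounded_linear D using D by (rule has_derivative_bounded_linear)
  interpret D': bounded_linear D' using D' by (rule has_derivative_bounded_linear)
  have dir: "D (y - x) = D' (y - x)" if "y \<in> S" for y
  proof -
    define \<gamma> where "\<gamma> s = x + s *\<^sub>R (y - x)" for s :: real
    have \<gamma>: "\<gamma> s \<in> S" if "s \<in> {0..1}" for s
      using convexD_alt[OF S(1) S(3) \<open>y \<in> S\<close>, of s] that by (simp add: \<gamma>_def algebra_simps)
    have d\<gamma>: "(\<gamma> has_vector_derivative (y - x)) (at 0 within {0..1})"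
      unfolding \<gamma>_def by (auto intro!: derivative_eq_intros)
    have *: "((f \<circ> \<gamma>) has_vector_derivative E (y - x)) (at 0 within {0..1})"
      if "(f has_derivative E) (at x within S)" for E
    proof (rule vector_derivative_diff_chain_within[OF d\<gamma>])
      show "(f has_derivative E) (at (\<gamma> 0) within \<gamma> ` {0..1})"
        by (rule has_derivative_subset[where s = S]) (use \<gamma> that in \<open>auto simp: \<gamma>_def\<close>)
    qed
    show ?thesis
      using vector_derivative_unique_within_closed_interval[of 0 "1::real" 0] *[OF D] *[OF D'] by auto
  qed
  obtain y0 e where e: "e > 0" "ball y0 e \<subseteq> S"
    using S(2) by (meson ex_in_conv mem_interior)
  show ?thesis
  proof
    fix v
    have "D i = D' i" if "i \<in> Basis" for i
    proof -
      have "y0 + (e / 2) *\<^sub>R i \<in> S" "y0 \<in> S"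
        using e that by (auto intro!: subsetD[OF e(2)] simp: dist_norm)
      then have "D (y0 + (e / 2) *\<^sub>R i - x) - D (y0 - x) = D' (y0 + (e / 2) *\<^sub>R i - x) - D' (y0 - x)"
        by (simp only: dir)
      then have "(e / 2) *\<^sub>R D i = (e / 2) *\<^sub>R D' i"
        by (simp add: D.add D.diff D.scaleR D'.add D'.diff D'.scaleR)
      with e(1) show ?thesis by simp
    qed
    then show "D v = D' v"
      using linear_eq_stdbasis[OF D.linear D'.linear] by blast
  qed
qed

lemma has_real_derivative_mixed_partial:
  fixes f f\<^sub>t f\<^sub>t\<^sub>z :: "real \<Rightarrow> real \<Rightarrow> real"
  assumes t: "t \<ge> 0"
    and ft: "\<And>s z. s \<ge> 0 \<Longrightarrow> ((\<lambda>s. f s z) has_real_derivative f\<^sub>t s z) (at s within {0..})"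
    and ftz: "\<And>s z. s \<ge> 0 \<Longrightarrow> ((\<lambda>z. f\<^sub>t s z) has_real_derivative f\<^sub>t\<^sub>z s z) (at z)"
    and cont: "continuous_on ({0..} \<times> UNIV) (\<lambda>(s, z). f\<^sub>t s z)"
      "continuous_on ({0..} \<times> UNIV) (\<lambda>(s, z). f\<^sub>t\<^sub>z s z)"
    and fz: "\<And>s. s \<ge> 0 \<Longrightarrow> ((\<lambda>z. f s z) has_real_derivative g s) (at \<zeta>)"
  shows "(g has_real_derivative f\<^sub>t\<^sub>z t \<zeta>) (at t within {0..})"
proof -
  have eq: "g s = g 0 + integral {0..s} (\<lambda>\<tau>. f\<^sub>t\<^sub>z \<tau> \<zeta>)" if s: "s \<ge> 0" for s
  proof -
    have FTC: "((\<lambda>\<tau>. f\<^sub>t \<tau> z) has_integral f s z - f 0 z) {0..s}" for z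
      using s by (intro fundamental_theorem_of_calculus)
        (auto simp flip: has_real_derivative_iff_has_vector_derivative intro: DERIV_subset[OF ft])
    have cont': "continuous_on (UNIV \<times> cbox 0 s) (\<lambda>(z, \<tau>). f\<^sub>t\<^sub>z \<tau> z)"
      unfolding case_prod_unfold by (rule continuous_on_case_prod[OF cont(2)]) (auto intro!: continuous_intros)
    have "((\<lambda>z. integral (cbox 0 s) (\<lambda>\<tau>. f\<^sub>t \<tau> z)) has_real_derivative
        integral (cbox 0 s) (\<lambda>\<tau>. f\<^sub>t\<^sub>z \<tau> \<zeta>)) (at \<zeta>)"
      using FTC by (intro leibniz_rule_field_derivative[OF ftz _ cont']) (auto simp: has_integral_integrable)
    moreover have "integral (cbox 0 s) (\<lambda>\<tau>. f\<^sub>t \<tau> z) = f s z - f 0 z" for z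
      using FTC by (simp add: integral_unique)
    ultimately have "((\<lambda>z. f s z - f 0 z) has_real_derivative integral (cbox 0 s) (\<lambda>\<tau>. f\<^sub>t\<^sub>z \<tau> \<zeta>)) (at \<zeta>)"
      by simp
    moreover have "((\<lambda>z. f s z - f 0 z) has_real_derivative g s - g 0) (at \<zeta>)"
      using fz[OF s] fz[of 0] by (auto intro!: derivative_eq_intros)
    ultimately show ?thesis
      using DERIV_unique by (metis box_real(2) diff_add_cancel add.commute)
  qed
  have cont1: "continuous_on {0..t + 1} (\<lambda>\<tau>. f\<^sub>t\<^sub>z \<tau> \<zeta>)"
    by (rule continuous_on_case_prod[OF cont(2)]) auto
  have "((\<lambda>s. g 0 + integral {0..s} (\<lambda>\<tau>. f\<^sub>t\<^sub>z \<tau> \<zeta>)) has_real_derivative f\<^sub>t\<^sub>z t \<zeta>) (at t within {0..t + 1})"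
    using integral_has_real_derivative[OF cont1, of t] t by (auto intro!: derivative_eq_intros)
  then have "(g has_real_derivative f\<^sub>t\<^sub>z t \<zeta>) (at t within {0..t + 1})"
    by (rule has_field_derivative_transform_within[where d = 1]) (use t in \<open>auto simp flip: eq\<close>)
  moreover have "at t within {0..t + 1} = at t within {0..}"
    by (rule at_within_nhd[of _ "{t - 1<..<t + 1}"]) auto
  ultimately show ?thesis by simp
qed

subsection \<open>Partial derivatives on the cylinder\<close>

definition partials_on ::
  "(real ^ 'n) set \<Rightarrow> (real ^ 'n \<Rightarrow> 'b::real_normed_vector) \<Rightarrow> ('n \<Rightarrow> real ^ 'n \<Rightarrow> 'b) \<Rightarrow> bool" where
  "partials_on X f f' \<longleftrightarrow>
     (\<forall>x\<in>X. (f has_derivative (\<lambda>h. \<Sum>j\<in>UNIV. h $ j *\<^sub>R f' j x)) (at x within X)) \<and>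
     (\<forall>j. continuous_on X (f' j))"

lemma partials_onD:
  assumes "partials_on X f f'"
  shows "x \<in> X \<Longrightarrow> (f has_derivative (\<lambda>h. \<Sum>j\<in>UNIV. h $ j *\<^sub>R f' j x)) (at x within X)"
    and "continuous_on X (f' j)" and "continuous_on X f"
  using assms unfolding partials_on_def by (auto intro: has_derivative_continuous_on)

lemma partials_on_diff:
  assumes "partials_on X f f'" "partials_on X g g'"
  shows "partials_on X (\<lambda>x. f x - g x) (\<lambda>j x. f' j x - g' j x)"
  using assms unfolding partials_on_def
  by (auto intro!: derivative_eq_intros continuous_intros simp: scaleR_right_diff_distrib sum_subtractf)

lemma partials_on_inner:
  fixes f g :: "real ^ 'n \<Rightarrow> 'b::real_inner"
  assumes "partials_on X f f'" "partials_on X g g'"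
  shows "partials_on X (\<lambda>x. f x \<bullet> g x) (\<lambda>j x. f' j x \<bullet> g x + f x \<bullet> g' j x)"
  unfolding partials_on_def
proof (intro conjI ballI allI)
  fix x assume "x \<in> X"
  from has_derivative_inner[OF partials_onD(1)[OF assms(1) this] partials_onD(1)[OF assms(2) this]]
  show "((\<lambda>x. f x \<bullet> g x) has_derivative
      (\<lambda>h. \<Sum>j\<in>UNIV. h $ j *\<^sub>R (f' j x \<bullet> g x + f x \<bullet> g' j x))) (at x within X)"
    by (rule has_derivative_eq_rhs)
      (simp add: inner_sum_left inner_sum_right distrib_left flip: sum.distrib add: add.commute)
next
  fix j show "continuous_on X (\<lambda>x. f' j x \<bullet> g x + f x \<bullet> g' j x)"
    using partials_onD[OF assms(1)] partials_onD[OF assms(2)] by (intro continuous_intros)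
qed

lemma sum_Basis_cart: "(\<Sum>i\<in>(Basis :: (real ^ 'n) set). F i) = (\<Sum>j\<in>UNIV. F (axis j 1))"
proof -
  have "(Basis :: (real ^ 'n) set) = (\<lambda>j. axis j 1) ` UNIV"
    by (auto simp: Basis_vec_def)
  then show ?thesis
    by (metis (mono_tags, lifting) sum.reindex_cong axis_eq_axis inj_onI zero_neq_one)
qed

lemma sum_axis_scaleR [simp]:
  fixes F :: "'n::finite \<Rightarrow> 'b::real_vector"
  shows "(\<Sum>j\<in>UNIV. axis i (1::real) $ j *\<^sub>R F j) = F i"
proof -
  have "axis i (1::real) $ j *\<^sub>R F j = (if i = j then F j else 0)" for j
    by (simp add: axis_def)
  then show ?thesis by simp
qed

lemma sum_Basis_time_space:
  "(\<Sum>i\<in>(Basis :: (real \<times> (real ^ 'n)) set). F i) = F (1, 0) + (\<Sum>j\<in>UNIV. F (0, axis j 1))"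
proof -
  have "(\<Sum>i\<in>(Basis :: (real \<times> (real ^ 'n)) set). F i) =
      (\<Sum>i\<in>Basis. F (i, 0)) + (\<Sum>i\<in>Basis. F (0, i))"
    unfolding Basis_prod_def
    by (subst sum.union_disjoint) (auto simp: inj_on_def sum.reindex)
  then show ?thesis
    by (simp add: sum_Basis_cart[of "\<lambda>i. F (0, i)"])
qed

lemma Ck_on_imp_continuous_on: "Ck_on k S f \<Longrightarrow> continuous_on S f"
proof (cases k)
  case (Suc k')
  moreover assume "Ck_on k S f"
  ultimately obtain g where "\<And>x. x \<in> S \<Longrightarrow>
      (f has_derivative (\<lambda>h. \<Sum>i\<in>Basis. (h \<bullet> i) *\<^sub>R g i x)) (at x within S)"
    by auto
  then show ?thesis
    by (rule has_derivative_continuous_on)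
qed simp

lemma Ck_on_partials:
  fixes f :: "real ^ 'n \<Rightarrow> 'b::real_normed_vector"
  assumes "Ck_on (Suc k) X f"
  obtains f' where "partials_on X f f'"
proof -
  from assms obtain g where
    g: "\<And>x. x \<in> X \<Longrightarrow> (f has_derivative (\<lambda>h. \<Sum>i\<in>Basis. (h \<bullet> i) *\<^sub>R g i x)) (at x within X)"
      "\<And>i. i \<in> Basis \<Longrightarrow> Ck_on k X (g i)"
    by auto
  have "partials_on X f (\<lambda>j. g (axis j 1))"
    unfolding partials_on_def
    using g by (auto simp: sum_Basis_cart inner_axis intro: Ck_on_imp_continuous_on[of k])
  then show ?thesis ..
qed

definition spacetime_partials_on ::
  "real set \<Rightarrow> (real ^ 'n) set \<Rightarrow> (real \<Rightarrow> real ^ 'n \<Rightarrow> 'b::real_normed_vector) \<Rightarrow>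
    (real \<Rightarrow> real ^ 'n \<Rightarrow> 'b) \<Rightarrow> ('n \<Rightarrow> real \<Rightarrow> real ^ 'n \<Rightarrow> 'b) \<Rightarrow> bool" where
  "spacetime_partials_on I X U U\<^sub>t U\<^sub>x \<longleftrightarrow>
     (\<forall>t\<in>I. \<forall>x\<in>X. ((\<lambda>(t, x). U t x) has_derivative
        (\<lambda>(s, h). s *\<^sub>R U\<^sub>t t x + (\<Sum>j\<in>UNIV. h $ j *\<^sub>R U\<^sub>x j t x))) (at (t, x) within I \<times> X)) \<and>
     continuous_on (I \<times> X) (\<lambda>(t, x). U\<^sub>t t x) \<and>
     (\<forall>j. continuous_on (I \<times> X) (\<lambda>(t, x). U\<^sub>x j t x))"

lemma Ck_on_spacetime_partials:
  fixes U :: "real \<Rightarrow> real ^ 'n \<Rightarrow> 'b::real_normed_vector"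
  assumes "Ck_on (Suc k) (I \<times> X) (\<lambda>(t, x). U t x)"
  obtains U\<^sub>t U\<^sub>x where "spacetime_partials_on I X U U\<^sub>t U\<^sub>x"
    "Ck_on k (I \<times> X) (\<lambda>(t, x). U\<^sub>t t x)" "\<forall>j. Ck_on k (I \<times> X) (\<lambda>(t, x). U\<^sub>x j t x)"
proof -
  from assms obtain g where
    g: "\<And>x. x \<in> I \<times> X \<Longrightarrow> ((\<lambda>(t, x). U t x) has_derivative
          (\<lambda>h. \<Sum>i\<in>Basis. (h \<bullet> i) *\<^sub>R g i x)) (at x within I \<times> X)"
      "\<And>i. i \<in> Basis \<Longrightarrow> Ck_on k (I \<times> X) (g i)"
    by auto
  have basis: "(1, 0) \<in> (Basis :: (real \<times> (real ^ 'n)) set)" "(0, axis j 1) \<in> (Basis :: (real \<times> (real ^ 'n)) set)" for j :: 'n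
    by (auto simp: Basis_prod_def)
  show ?thesis
  proof
    show "spacetime_partials_on I X U (\<lambda>t x. g (1, 0) (t, x)) (\<lambda>j t x. g (0, axis j 1) (t, x))"
      unfolding spacetime_partials_on_def
    proof (intro conjI ballI allI)
      fix t x assume "t \<in> I" "x \<in> X"
      then have "((\<lambda>(t, x). U t x) has_derivative
          (\<lambda>h. \<Sum>i\<in>Basis. (h \<bullet> i) *\<^sub>R g i (t, x))) (at (t, x) within I \<times> X)"
        by (intro g) auto
      then show "((\<lambda>(t, x). U t x) has_derivative (\<lambda>(s, h). s *\<^sub>R g (1, 0) (t, x) +
          (\<Sum>j\<in>UNIV. h $ j *\<^sub>R g (0, axis j 1) (t, x)))) (at (t, x) within I \<times> X)"
        by (rule has_derivative_eq_rhs) (auto simp: sum_Basis_time_space inner_axis)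
    qed (use basis in \<open>auto intro!: Ck_on_imp_continuous_on[OF g(2)]\<close>)
    show "Ck_on k (I \<times> X) (\<lambda>(t, x). g (1, 0) (t, x))"
      using g(2)[OF basis(1)] by simp
    show "\<forall>j. Ck_on k (I \<times> X) (\<lambda>(t, x). g (0, axis j 1) (t, x))"
      using g(2)[OF basis(2)] by simp
  qed
qed

lemma spacetime_partials_onD:
  assumes U: "spacetime_partials_on I X U U\<^sub>t U\<^sub>x"
  shows "t \<in> I \<Longrightarrow> partials_on X (U t) (\<lambda>j. U\<^sub>x j t)"
    and "t \<in> I \<Longrightarrow> x \<in> X \<Longrightarrow> ((\<lambda>s. U s x) has_vector_derivative U\<^sub>t t x) (at t within I)"
    and "continuous_on (I \<times> X) (\<lambda>(t, x). U t x)"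
    and "continuous_on (I \<times> X) (\<lambda>(t, x). U\<^sub>t t x)"
    and "continuous_on (I \<times> X) (\<lambda>(t, x). U\<^sub>x j t x)"
proof -
  have D: "((\<lambda>(t, x). U t x) has_derivative
        (\<lambda>(s, h). s *\<^sub>R U\<^sub>t t x + (\<Sum>j\<in>UNIV. h $ j *\<^sub>R U\<^sub>x j t x))) (at (t, x) within I \<times> X)"
    if "t \<in> I" "x \<in> X" for t x
    using U that unfolding spacetime_partials_on_def by blast
  show ct: "continuous_on (I \<times> X) (\<lambda>(t, x). U\<^sub>t t x)"
    and cx: "continuous_on (I \<times> X) (\<lambda>(t, x). U\<^sub>x j t x)" for j
    using U unfolding spacetime_partials_on_def by auto
  show "continuous_on (I \<times> X) (\<lambda>(t, x). U t x)"
  proof (rule has_derivative_continuous_on)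
    fix p assume "p \<in> I \<times> X"
    then show "((\<lambda>(t, x). U t x) has_derivative (\<lambda>(s, h). s *\<^sub>R U\<^sub>t (fst p) (snd p) +
        (\<Sum>j\<in>UNIV. h $ j *\<^sub>R U\<^sub>x j (fst p) (snd p)))) (at p within I \<times> X)"
      using D[of "fst p" "snd p"] by auto
  qed
  show "partials_on X (U t) (\<lambda>j. U\<^sub>x j t)" if t: "t \<in> I"
    unfolding partials_on_def
  proof (intro conjI ballI allI)
    fix x assume x: "x \<in> X"
    have "((\<lambda>y. (t, y)) has_derivative (\<lambda>h. (0, h))) (at x within X)"
      by (auto intro!: derivative_eq_intros)
    moreover have "((\<lambda>(t, x). U t x) has_derivative
        (\<lambda>(s, h). s *\<^sub>R U\<^sub>t t x + (\<Sum>j\<in>UNIV. h $ j *\<^sub>R U\<^sub>x j t x))) (at (t, x) within (\<lambda>y. (t, y)) ` X)"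
      using t x by (intro has_derivative_subset[OF D]) auto
    ultimately have "((\<lambda>y. case (t, y) of (t, x) \<Rightarrow> U t x) has_derivative
        (\<lambda>h. case (0, h) of (s, h) \<Rightarrow> s *\<^sub>R U\<^sub>t t x + (\<Sum>j\<in>UNIV. h $ j *\<^sub>R U\<^sub>x j t x))) (at x within X)"
      by (rule has_derivative_in_compose)
    then show "(U t has_derivative (\<lambda>h. \<Sum>j\<in>UNIV. h $ j *\<^sub>R U\<^sub>x j t x)) (at x within X)"
      by simp
  next
    fix j show "continuous_on X (U\<^sub>x j t)"
      by (rule continuous_on_case_prod[OF cx]) (use t in auto)
  qed
  show "((\<lambda>s. U s x) has_vector_derivative U\<^sub>t t x) (at t within I)" if "t \<in> I" "x \<in> X"
  proof -
    have "((\<lambda>s. (s, x)) has_derivative (\<lambda>h. (h, 0))) (at t within I)"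
      by (auto intro!: derivative_eq_intros)
    moreover have "((\<lambda>(t, x). U t x) has_derivative
        (\<lambda>(s, h). s *\<^sub>R U\<^sub>t t x + (\<Sum>j\<in>UNIV. h $ j *\<^sub>R U\<^sub>x j t x))) (at (t, x) within (\<lambda>s. (s, x)) ` I)"
      using that by (intro has_derivative_subset[OF D]) auto
    ultimately have "((\<lambda>s. case (s, x) of (t, x) \<Rightarrow> U t x) has_derivative
        (\<lambda>h. case (h, 0) of (s, h) \<Rightarrow> s *\<^sub>R U\<^sub>t t x + (\<Sum>j\<in>UNIV. h $ j *\<^sub>R U\<^sub>x j t x))) (at t within I)"
      by (rule has_derivative_in_compose)
    then show ?thesis
      by (simp add: has_vector_derivative_def)
  qed
qed

lemma convex_cylinder: "convex cylinder"
proof -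
  define L where "L x = (x $ 1, x $ 2)" for x :: "real ^ 3"
  have "linear L"
    by (auto simp: L_def intro!: linearI)
  moreover have "cylinder = L -` cball 0 1"
    by (auto simp: cylinder_def L_def norm_Pair)
  ultimately show ?thesis
    using convex_linear_vimage[of L "cball 0 1"] by simp
qed

lemma interior_cylinder_nonempty: "interior cylinder \<noteq> {}"
proof -
  have "open {x :: real ^ 3. (x $ 1)\<^sup>2 + (x $ 2)\<^sup>2 < 1}"
    by (intro open_Collect_less continuous_intros)
  then have "0 \<in> interior cylinder"
    by (rule interiorI) (auto simp: cylinder_def)
  then show ?thesis by auto
qed

lemmas has_derivative_unique_cylinder =
  has_derivative_unique_convex[OF convex_cylinder interior_cylinder_nonempty]

lemma frechet_derivative_cylinder:
  assumes "partials_on cylinder f f'" "x \<in> cylinder"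
  shows "frechet_derivative f (at x within cylinder) = (\<lambda>h. \<Sum>j\<in>UNIV. h $ j *\<^sub>R f' j x)"
proof (rule has_derivative_unique_cylinder)
  show D: "(f has_derivative (\<lambda>h. \<Sum>j\<in>UNIV. h $ j *\<^sub>R f' j x)) (at x within cylinder)"
    using partials_onD(1)[OF assms] .
  then show "(f has_derivative frechet_derivative f (at x within cylinder)) (at x within cylinder)"
    by (auto simp: differentiable_def simp flip: frechet_derivative_works)
qed fact

lemma grad_eq:
  assumes "partials_on cylinder f f'" "x \<in> cylinder"
  shows "grad f x = (\<chi> j. f' j x)"
  unfolding grad_def frechet_derivative_cylinder[OF assms]
  by (simp add: vec_eq_iff del: real_scaleR_def)

lemma nabla_mult_eq:
  assumes "partials_on cylinder V V'" "x \<in> cylinder"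
  shows "nabla V x *v v = (\<Sum>j\<in>UNIV. v $ j *\<^sub>R V' j x)"
proof -
  have D: "(V has_derivative (\<lambda>h. \<Sum>j\<in>UNIV. h $ j *\<^sub>R V' j x)) (at x within cylinder)"
    using partials_onD(1)[OF assms] .
  then have "(V has_derivative (\<lambda>h. nabla V x *v h)) (at x within cylinder)"
    unfolding nabla_def using differentiableI jacobian_works by blast
  from has_derivative_unique_cylinder[OF assms(2) this D] show ?thesis
    by (rule fun_cong)
qed

lemma divergence_eq:
  assumes "partials_on cylinder V V'" "x \<in> cylinder"
  shows "divergence V x = (\<Sum>j\<in>UNIV. V' j x $ j)"
proof -
  have "nabla V x $ j $ j = V' j x $ j" for j
  proof -
    have "nabla V x $ j $ j = (nabla V x *v axis j 1) $ j"
      by (simp add: matrix_vector_mul_component inner_axis)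
    also have "\<dots> = V' j x $ j"
      unfolding nabla_mult_eq[OF assms] by simp
    finally show ?thesis .
  qed
  then show ?thesis
    by (simp add: divergence_def trace_def)
qed

lemma cyl_point_nth [simp]:
  "cyl_point r \<theta> z $ 1 = r * cos \<theta>" "cyl_point r \<theta> z $ 2 = r * sin \<theta>" "cyl_point r \<theta> z $ 3 = z"
  by (simp_all add: cyl_point_def)

lemma cyl_frame_nth [simp]:
  "e_r \<theta> $ 1 = cos \<theta>" "e_r \<theta> $ 2 = sin \<theta>" "e_r \<theta> $ 3 = 0"
  "e_theta \<theta> $ 1 = - sin \<theta>" "e_theta \<theta> $ 2 = cos \<theta>" "e_theta \<theta> $ 3 = 0"
  "e_z $ 1 = 0" "e_z $ 2 = 0" "e_z $ 3 = 1"
  by (simp_all add: e_r_def e_theta_def e_z_def)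

lemma cyl_point_in_cylinder [simp]: "r \<in> {0..1} \<Longrightarrow> cyl_point r \<theta> z \<in> cylinder"
  by (simp add: cylinder_def power_mult_distrib abs_square_le_1 flip: distrib_left)

lemma cyl_point_eq:
  "cyl_point r \<theta> z = (r * cos \<theta>) *\<^sub>R axis 1 1 + (r * sin \<theta>) *\<^sub>R axis 2 1 + z *\<^sub>R axis 3 1"
  by (simp add: vec_eq_iff forall_3 axis_def)

lemma continuous_on_cyl_point [continuous_intros]:
  fixes f g h :: "'a::t2_space \<Rightarrow> real"
  assumes "continuous_on A f" "continuous_on A g" "continuous_on A h"
  shows "continuous_on A (\<lambda>x. cyl_point (f x) (g x) (h x))"
  unfolding cyl_point_eq using assms by (auto intro!: continuous_intros)

lemma has_vector_derivative_cyl_curve: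
  assumes f: "partials_on cylinder f f'"
    and \<gamma>: "(\<gamma> has_vector_derivative v) (at s within A)" "\<And>s. s \<in> A \<Longrightarrow> \<gamma> s \<in> cylinder" "s \<in> A"
  shows "((\<lambda>s. f (\<gamma> s)) has_vector_derivative (\<Sum>j\<in>UNIV. v $ j *\<^sub>R f' j (\<gamma> s))) (at s within A)"
proof -
  have "(f has_derivative (\<lambda>h. \<Sum>j\<in>UNIV. h $ j *\<^sub>R f' j (\<gamma> s))) (at (\<gamma> s) within \<gamma> ` A)"
    by (rule has_derivative_subset[OF partials_onD(1)[OF f]]) (use \<gamma> in auto)
  from vector_derivative_diff_chain_within[OF \<gamma>(1) this] show ?thesis
    by (simp add: o_def)
qed

lemma cyl_point_has_vector_derivative:
  "((\<lambda>r. cyl_point r \<theta> z) has_vector_derivative e_r \<theta>) (at r within A)"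
  "((\<lambda>\<theta>. cyl_point r \<theta> z) has_vector_derivative r *\<^sub>R e_theta \<theta>) (at \<theta> within A)"
  "((\<lambda>z. cyl_point r \<theta> z) has_vector_derivative e_z) (at z within A)"
  unfolding cyl_point_eq has_vector_derivative_def
  by (auto intro!: derivative_eq_intros simp: vec_eq_iff forall_3 axis_def fun_eq_iff)

subsection \<open>Axisymmetric fluxes\<close>

lemma has_vector_derivative_cyl_coordinate:
  assumes f: "partials_on cylinder f f'" and r: "r \<in> {0..1}"
  shows "((\<lambda>r. f (cyl_point r 0 z)) has_vector_derivative f' 1 (cyl_point r 0 z)) (at r within {0..1})"
    and "((\<lambda>\<theta>. f (cyl_point r \<theta> z)) has_vector_derivative r *\<^sub>R f' 2 (cyl_point r 0 z)) (at 0)"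
    and "((\<lambda>z. f (cyl_point r 0 z)) has_vector_derivative f' 3 (cyl_point r 0 z)) (at z within A)"
proof -
  show "((\<lambda>r. f (cyl_point r 0 z)) has_vector_derivative f' 1 (cyl_point r 0 z)) (at r within {0..1})"
    using has_vector_derivative_cyl_curve[OF f cyl_point_has_vector_derivative(1)[of 0 z r "{0..1}"]] r
    by (simp add: sum_3)
  show "((\<lambda>\<theta>. f (cyl_point r \<theta> z)) has_vector_derivative r *\<^sub>R f' 2 (cyl_point r 0 z)) (at 0)"
    using has_vector_derivative_cyl_curve[OF f cyl_point_has_vector_derivative(2)[of r z 0 UNIV]] r
    by (simp add: sum_3)
  have "((\<lambda>z. f (cyl_point r 0 z)) has_vector_derivative f' 3 (cyl_point r 0 z)) (at z)"
    using has_vector_derivative_cyl_curve[OF f cyl_point_has_vector_derivative(3)[of r 0 z UNIV]] r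
    by (simp add: sum_3)
  then show "((\<lambda>z. f (cyl_point r 0 z)) has_vector_derivative f' 3 (cyl_point r 0 z)) (at z within A)"
    by (rule has_vector_derivative_at_within)
qed

lemma cyl_frame_eq:
  "e_r \<theta> = cos \<theta> *\<^sub>R axis 1 1 + sin \<theta> *\<^sub>R axis 2 1"
  "e_theta \<theta> = - sin \<theta> *\<^sub>R axis 1 1 + cos \<theta> *\<^sub>R axis 2 1"
  by (auto simp: vec_eq_iff forall_3 axis_def)

lemma axisymmetric_function_angular:
  assumes "partials_on cylinder f f'" "axisymmetric_function f F" "r \<in> {0..1}"
  shows "r * f' 2 (cyl_point r 0 z) = 0"
proof -
  have "((\<lambda>\<theta>. f (cyl_point r \<theta> z)) has_vector_derivative 0) (at 0)"
    using assms(2,3) by (simp add: axisymmetric_function_def)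
  from vector_derivative_unique_at[OF this has_vector_derivative_cyl_coordinate(2)[OF assms(1,3)]]
  show ?thesis by simp
qed

lemma axisymmetric_field_angular:
  assumes "partials_on cylinder V V'" "axisymmetric_field V a b c" "r \<in> {0..1}"
  shows "r *\<^sub>R V' 2 (cyl_point r 0 z) = a r z *\<^sub>R e_theta 0 - b r z *\<^sub>R e_r 0"
proof -
  have "((\<lambda>\<theta>. a r z *\<^sub>R e_r \<theta> + b r z *\<^sub>R e_theta \<theta> + c r z *\<^sub>R e_z) has_vector_derivative
      a r z *\<^sub>R e_theta 0 - b r z *\<^sub>R e_r 0) (at 0)"
    unfolding cyl_frame_eq has_vector_derivative_def
    by (auto intro!: derivative_eq_intros simp: fun_eq_iff algebra_simps)
  then have "((\<lambda>\<theta>. V (cyl_point r \<theta> z)) has_vector_derivative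
      a r z *\<^sub>R e_theta 0 - b r z *\<^sub>R e_r 0) (at 0)"
    using assms(2,3) by (simp add: axisymmetric_field_def)
  from vector_derivative_unique_at[OF this has_vector_derivative_cyl_coordinate(2)[OF assms(1,3)]]
  show ?thesis by simp
qed

lemma z_periodic_cyl_point:
  assumes "z_periodic f" "r \<in> {0..1}"
  shows "f (cyl_point r \<theta> (z + 2 * pi)) = f (cyl_point r \<theta> z)"
proof -
  have "cyl_point r \<theta> (z + 2 * pi) = cyl_point r \<theta> z + vector [0, 0, 2 * pi]"
    by (simp add: vec_eq_iff forall_3)
  then show ?thesis
    using assms by (simp add: z_periodic_def)
qed

text \<open>On the half-plane \<open>\<theta> = 0\<close> the integrand is \<open>(r W\<^sub>1 f)\<^sub>r + (r W\<^sub>3 f)\<^sub>z\<close>, because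
  \<open>r div W = (r W\<^sub>1)\<^sub>r + (r W\<^sub>3)\<^sub>z\<close> there.\<close>

lemma axisymmetric_flux_integral:
  fixes W :: "real ^ 3 \<Rightarrow> real ^ 3" and f :: "real ^ 3 \<Rightarrow> real"
  assumes W: "partials_on cylinder W W'" and f: "partials_on cylinder f f'"
    and div: "\<And>x. x \<in> cylinder \<Longrightarrow> (\<Sum>j\<in>UNIV. W' j x $ j) = 0"
    and tangential: "\<And>\<theta> z. W (cyl_point 1 \<theta> z) \<bullet> e_r \<theta> = 0"
    and axi: "axisymmetric_field W a b c" "axisymmetric_function f F"
    and per: "z_periodic W" "z_periodic f"
  shows "integral (cbox (0, - pi) (1, pi))
     (\<lambda>(r, z). r * (\<Sum>j\<in>UNIV. W (cyl_point r 0 z) $ j * f' j (cyl_point r 0 z))) = 0"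
proof -
  define A where "A r z = W (cyl_point r 0 z) $ 1" for r z
  define C where "C r z = W (cyl_point r 0 z) $ 3" for r z
  define \<phi> where "\<phi> r z = f (cyl_point r 0 z)" for r z
  define G where "G r z = A r z * \<phi> r z + r * W' 1 (cyl_point r 0 z) $ 1 * \<phi> r z
    + r * A r z * f' 1 (cyl_point r 0 z)" for r z
  define H where "H r z = r * W' 3 (cyl_point r 0 z) $ 3 * \<phi> r z + r * C r z * f' 3 (cyl_point r 0 z)" for r z
  define R where "R = cbox (0, - pi) (1::real, pi)"
  have R: "R = {0..1} \<times> {- pi..pi}"
    by (simp add: R_def cbox_Pair_eq)
  have slice: "continuous_on R (\<lambda>p. g (cyl_point (fst p) 0 (snd p)))"
    if "continuous_on cylinder g" for g :: "real ^ 3 \<Rightarrow> 'z::topological_space"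
    using that by (rule continuous_on_compose2) (auto intro!: continuous_intros simp: R)
  note cont = slice[OF partials_onD(2)[OF W]] slice[OF partials_onD(3)[OF W]]
    slice[OF partials_onD(2)[OF f]] slice[OF partials_onD(3)[OF f]]
  have contG: "continuous_on R (\<lambda>p. G (fst p) (snd p))" and contH: "continuous_on R (\<lambda>p. H (fst p) (snd p))"
    unfolding G_def H_def A_def C_def \<phi>_def by (intro continuous_intros cont)+
  have eq: "r * (\<Sum>j\<in>UNIV. W (cyl_point r 0 z) $ j * f' j (cyl_point r 0 z)) = G r z + H r z"
    if "r \<in> {0..1}" for r z
  proof -
    have "r *\<^sub>R W' 2 (cyl_point r 0 z) $ 2 = A r z"
      using arg_cong[OF axisymmetric_field_angular[OF W axi(1) that, of z], of "\<lambda>v. v $ 2"] axi(1) that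
      by (simp add: A_def axisymmetric_field_def)
    then have "r * W' 1 (cyl_point r 0 z) $ 1 + A r z + r * W' 3 (cyl_point r 0 z) $ 3 = 0"
      using arg_cong[OF div[of "cyl_point r 0 z"], of "\<lambda>v. r * v"] that
      by (simp add: sum_3 algebra_simps)
    then have 1: "\<phi> r z * (r * W' 1 (cyl_point r 0 z) $ 1 + A r z + r * W' 3 (cyl_point r 0 z) $ 3) = 0"
      by simp
    have 2: "W (cyl_point r 0 z) $ 2 * (r * f' 2 (cyl_point r 0 z)) = 0"
      using axisymmetric_function_angular[OF f axi(2) that] by simp
    show ?thesis
      using 1 2 by (simp add: G_def H_def A_def C_def sum_3 algebra_simps)
  qed
  have r_integral: "integral {0..1} (\<lambda>r. G r z) = 0" for z
  proof -
    have "((\<lambda>r. G r z) has_integral 1 * A 1 z * \<phi> 1 z - 0 * A 0 z * \<phi> 0 z) {0..1}"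
    proof (rule fundamental_theorem_of_calculus)
      fix r :: real assume r: "r \<in> {0..1}"
      have "((\<lambda>r. A r z) has_real_derivative W' 1 (cyl_point r 0 z) $ 1) (at r within {0..1})"
        using bounded_linear.has_vector_derivative[OF bounded_linear_vec_nth
            has_vector_derivative_cyl_coordinate(1)[OF W r]]
        by (simp add: A_def has_real_derivative_iff_has_vector_derivative)
      moreover have "((\<lambda>r. \<phi> r z) has_real_derivative f' 1 (cyl_point r 0 z)) (at r within {0..1})"
        using has_vector_derivative_cyl_coordinate(1)[OF f r]
        by (simp add: \<phi>_def has_real_derivative_iff_has_vector_derivative)
      ultimately show "((\<lambda>r. r * A r z * \<phi> r z) has_vector_derivative G r z) (at r within {0..1})"
        unfolding has_real_derivative_iff_has_vector_derivative[symmetric]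
        by (auto intro!: derivative_eq_intros simp: G_def algebra_simps)
    qed simp
    moreover have "A 1 z = 0"
      using tangential[of 0 z] by (simp add: A_def inner_vec_def sum_3)
    ultimately show ?thesis
      by (simp add: integral_unique)
  qed
  have z_integral: "integral {- pi..pi} (\<lambda>z. H r z) = 0" if r: "r \<in> {0..1}" for r
  proof -
    have "((\<lambda>z. H r z) has_integral r * C r pi * \<phi> r pi - r * C r (- pi) * \<phi> r (- pi)) {- pi..pi}"
    proof (rule fundamental_theorem_of_calculus)
      fix z
      have "((\<lambda>z. C r z) has_real_derivative W' 3 (cyl_point r 0 z) $ 3) (at z within {- pi..pi})"
        using bounded_linear.has_vector_derivative[OF bounded_linear_vec_nth
            has_vector_derivative_cyl_coordinate(3)[OF W r]]
        by (simp add: C_def has_real_derivative_iff_has_vector_derivative)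
      moreover have "((\<lambda>z. \<phi> r z) has_real_derivative f' 3 (cyl_point r 0 z)) (at z within {- pi..pi})"
        using has_vector_derivative_cyl_coordinate(3)[OF f r]
        by (simp add: \<phi>_def has_real_derivative_iff_has_vector_derivative)
      ultimately show "((\<lambda>z. r * C r z * \<phi> r z) has_vector_derivative H r z) (at z within {- pi..pi})"
        unfolding has_real_derivative_iff_has_vector_derivative[symmetric]
        by (auto intro!: derivative_eq_intros simp: H_def algebra_simps)
    qed simp
    moreover have "C r pi = C r (- pi)" "\<phi> r pi = \<phi> r (- pi)"
      using z_periodic_cyl_point[OF per(1) r, of 0 "- pi"] z_periodic_cyl_point[OF per(2) r, of 0 "- pi"]
      by (simp_all add: C_def \<phi>_def)
    ultimately show ?thesis
      by (simp add: integral_unique)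
  qed
  have "integral R (\<lambda>(r, z). r * (\<Sum>j\<in>UNIV. W (cyl_point r 0 z) $ j * f' j (cyl_point r 0 z)))
      = integral R (\<lambda>p. G (fst p) (snd p) + H (fst p) (snd p))"
    using eq by (intro integral_cong) (auto simp: R)
  also have "\<dots> = integral R (\<lambda>p. G (fst p) (snd p)) + integral R (\<lambda>p. H (fst p) (snd p))"
    using contG contH unfolding R_def by (intro integral_add integrable_continuous)
  also have "integral R (\<lambda>p. H (fst p) (snd p)) = integral {0..1} (\<lambda>r. integral {- pi..pi} (\<lambda>z. H r z))"
    using integral_prod_continuous[OF contH[unfolded R_def]] by (simp add: R_def)
  also have "\<dots> = integral {0..1} (\<lambda>r::real. 0)"
    using z_integral by (intro integral_cong) auto
  also have "integral R (\<lambda>p. G (fst p) (snd p)) = integral {0..1} (\<lambda>r. integral {- pi..pi} (\<lambda>z. G r z))"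
    using integral_prod_continuous[OF contG[unfolded R_def]] by (simp add: R_def)
  also have "\<dots> = integral {- pi..pi} (\<lambda>z. integral {0..1} (\<lambda>r. G r z))"
    using integral_swap_continuous[of 0 "- pi" 1 pi G] contG by (simp add: R_def case_prod_unfold)
  finally show ?thesis
    using r_integral by (simp add: R_def)
qed

subsection \<open>Uniqueness of axisymmetric Euler solutions\<close>

lemma times_before_Icc: "t \<in> times_before T \<Longrightarrow> {0..t} \<subseteq> times_before T"
  by (auto simp: times_before_def intro: order.strict_trans1[of "ereal _" "ereal t" T])

lemma at_within_times_before:
  assumes "t \<in> times_before T"
  shows "at t within times_before T \<noteq> bot"
proof -
  obtain u where u: "t < u" "ereal u < T"
    using assms ereal_dense2[of "ereal t" T] by (auto simp: times_before_def)
  then have "{t..u} \<subseteq> times_before T"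
    using times_before_Icc[of u T] assms by (fastforce simp: times_before_def)
  moreover have "at t within {t..u} \<noteq> bot"
    using u by (simp add: trivial_limit_within islimpt_Icc)
  ultimately show ?thesis
    using at_le bot.extremum_uniqueI by metis
qed

lemma spacetime_partials_on_subset:
  assumes "spacetime_partials_on I X U U\<^sub>t U\<^sub>x" "J \<subseteq> I"
  shows "spacetime_partials_on J X U U\<^sub>t U\<^sub>x"
  using assms(1) unfolding spacetime_partials_on_def
  by (auto intro: has_derivative_subset[where t = "J \<times> X"] continuous_on_subset
      dest!: subsetD[OF assms(2)] intro!: Sigma_mono assms(2))

definition euler_equations ::
  "real set \<Rightarrow> (real \<Rightarrow> real ^ 3 \<Rightarrow> real ^ 3) \<Rightarrow> (real \<Rightarrow> real ^ 3 \<Rightarrow> real ^ 3) \<Rightarrow>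
    (3 \<Rightarrow> real \<Rightarrow> real ^ 3 \<Rightarrow> real ^ 3) \<Rightarrow> (real \<Rightarrow> real ^ 3 \<Rightarrow> real) \<Rightarrow> (3 \<Rightarrow> real \<Rightarrow> real ^ 3 \<Rightarrow> real) \<Rightarrow> bool"
where
  "euler_equations I U U\<^sub>t U\<^sub>x p p\<^sub>x \<longleftrightarrow>
     spacetime_partials_on I cylinder U U\<^sub>t U\<^sub>x \<and>
     (\<forall>t\<in>I. partials_on cylinder (p t) (\<lambda>j. p\<^sub>x j t)) \<and>
     (\<forall>t\<in>I. z_periodic (U t) \<and> z_periodic (p t)) \<and>
     (\<forall>t\<in>I. \<forall>x\<in>cylinder. U\<^sub>t t x = - (\<chi> j. p\<^sub>x j t x) - (\<Sum>j\<in>UNIV. U t x $ j *\<^sub>R U\<^sub>x j t x)) \<and>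
     (\<forall>t\<in>I. \<forall>x\<in>cylinder. (\<Sum>j\<in>UNIV. U\<^sub>x j t x $ j) = 0) \<and>
     (\<forall>t\<in>I. \<forall>\<theta> z. U t (cyl_point 1 \<theta> z) \<bullet> e_r \<theta> = 0)"

lemma euler_solution_equations:
  assumes "euler_solution U0 T U p"
  obtains U\<^sub>t U\<^sub>x p\<^sub>x where "euler_equations (times_before T) U U\<^sub>t U\<^sub>x p p\<^sub>x"
    "Ck_on 1 (times_before T \<times> cylinder) (\<lambda>(t, x). U\<^sub>t t x)"
    "\<forall>j. Ck_on 1 (times_before T \<times> cylinder) (\<lambda>(t, x). U\<^sub>x j t x)"
proof -
  define I where "I = times_before T"
  have sol: "smooth_on (I \<times> cylinder) (\<lambda>(t, x). U t x)"
    "\<And>t. t \<in> I \<Longrightarrow> smooth_on cylinder (p t)"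
    "\<And>t. t \<in> I \<Longrightarrow> z_periodic (U t) \<and> z_periodic (p t)"
    "\<And>t x. t \<in> I \<Longrightarrow> x \<in> cylinder \<Longrightarrow>
        ((\<lambda>s. U s x) has_vector_derivative (- grad (p t) x - nabla (U t) x *v U t x)) (at t within I)"
    "\<And>t x. t \<in> I \<Longrightarrow> x \<in> cylinder \<Longrightarrow> divergence (U t) x = 0"
    "\<And>t \<theta> z. t \<in> I \<Longrightarrow> U t (cyl_point 1 \<theta> z) \<bullet> e_r \<theta> = 0"
    using assms unfolding euler_solution_def I_def by auto
  have "Ck_on (Suc 1) (I \<times> cylinder) (\<lambda>(t, x). U t x)"
    using sol(1) unfolding smooth_on_def by blast
  then obtain U\<^sub>t U\<^sub>x where U: "spacetime_partials_on I cylinder U U\<^sub>t U\<^sub>x"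
    and C1: "Ck_on 1 (I \<times> cylinder) (\<lambda>(t, x). U\<^sub>t t x)" "\<forall>j. Ck_on 1 (I \<times> cylinder) (\<lambda>(t, x). U\<^sub>x j t x)"
    by (rule Ck_on_spacetime_partials)
  have "\<exists>f'. partials_on cylinder (p t) f'" if "t \<in> I" for t
    using sol(2)[OF that] Ck_on_partials unfolding smooth_on_def by metis
  then obtain P where P: "\<And>t. t \<in> I \<Longrightarrow> partials_on cylinder (p t) (P t)"
    by metis
  have "euler_equations I U U\<^sub>t U\<^sub>x p (\<lambda>j t. P t j)"
    unfolding euler_equations_def
  proof (intro conjI ballI allI)
    fix t x assume t: "t \<in> I" and x: "x \<in> cylinder"
    note Ux = spacetime_partials_onD(1)[OF U t]
    show "U\<^sub>t t x = - (\<chi> j. P t j x) - (\<Sum>j\<in>UNIV. U t x $ j *\<^sub>R U\<^sub>x j t x)"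
      using vector_derivative_unique_within[OF at_within_times_before
          spacetime_partials_onD(2)[OF U t x, unfolded I_def] sol(4)[OF t x, unfolded I_def]] t
      by (simp add: I_def grad_eq[OF P[OF t] x] nabla_mult_eq[OF Ux x])
    show "(\<Sum>j\<in>UNIV. U\<^sub>x j t x $ j) = 0"
      using sol(5)[OF t x] by (simp add: divergence_eq[OF Ux x])
  qed (use U P sol(3,6) in auto)
  with C1 show ?thesis
    using that unfolding I_def by blast
qed

lemma euler_equationsD:
  assumes "euler_equations I U U\<^sub>t U\<^sub>x p p\<^sub>x"
  shows "spacetime_partials_on I cylinder U U\<^sub>t U\<^sub>x"
    and "t \<in> I \<Longrightarrow> partials_on cylinder (p t) (\<lambda>j. p\<^sub>x j t)"
    and "t \<in> I \<Longrightarrow> partials_on cylinder (U t) (\<lambda>j. U\<^sub>x j t)"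
    and "t \<in> I \<Longrightarrow> z_periodic (U t)" and "t \<in> I \<Longrightarrow> z_periodic (p t)"
    and "t \<in> I \<Longrightarrow> x \<in> cylinder \<Longrightarrow>
      U\<^sub>t t x = - (\<chi> j. p\<^sub>x j t x) - (\<Sum>j\<in>UNIV. U t x $ j *\<^sub>R U\<^sub>x j t x)"
    and "t \<in> I \<Longrightarrow> x \<in> cylinder \<Longrightarrow> (\<Sum>j\<in>UNIV. U\<^sub>x j t x $ j) = 0"
    and "t \<in> I \<Longrightarrow> U t (cyl_point 1 \<theta> z) \<bullet> e_r \<theta> = 0"
  using assms spacetime_partials_onD(1) unfolding euler_equations_def by blast+

lemma euler_equations_subset:
  "euler_equations I U U\<^sub>t U\<^sub>x p p\<^sub>x \<Longrightarrow> J \<subseteq> I \<Longrightarrow> euler_equations J U U\<^sub>t U\<^sub>x p p\<^sub>x"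
  unfolding euler_equations_def using spacetime_partials_on_subset by blast

lemma axisymmetric_field_diff:
  "axisymmetric_field V a b c \<Longrightarrow> axisymmetric_field V' a' b' c' \<Longrightarrow>
    axisymmetric_field (\<lambda>x. V x - V' x) (\<lambda>r z. a r z - a' r z) (\<lambda>r z. b r z - b' r z) (\<lambda>r z. c r z - c' r z)"
  by (auto simp: axisymmetric_field_def algebra_simps)

lemma axisymmetric_field_norm_square:
  assumes "axisymmetric_field V a b c"
  shows "axisymmetric_function (\<lambda>x. V x \<bullet> V x) (\<lambda>r z. (a r z)\<^sup>2 + (b r z)\<^sup>2 + (c r z)\<^sup>2)"
  unfolding axisymmetric_function_def
proof (intro ballI allI)
  fix r :: real and \<theta> z assume "r \<in> {0..1}"
  then have "V (cyl_point r \<theta> z) = a r z *\<^sub>R e_r \<theta> + b r z *\<^sub>R e_theta \<theta> + c r z *\<^sub>R e_z"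
    using assms by (simp add: axisymmetric_field_def)
  moreover have "e_r \<theta> \<bullet> e_r \<theta> = 1" "e_theta \<theta> \<bullet> e_theta \<theta> = 1" "e_z \<bullet> e_z = 1"
    "e_r \<theta> \<bullet> e_theta \<theta> = 0" "e_r \<theta> \<bullet> e_z = 0" "e_theta \<theta> \<bullet> e_z = 0"
    by (simp_all add: inner_vec_def sum_3 flip: power2_eq_square)
  ultimately show "V (cyl_point r \<theta> z) \<bullet> V (cyl_point r \<theta> z) = (a r z)\<^sup>2 + (b r z)\<^sup>2 + (c r z)\<^sup>2"
    by (simp add: inner_simps inner_commute power2_eq_square)
qed

text \<open>The energy of the difference of two solutions, over the half-plane \<open>\<theta> = 0\<close> with the weight \<open>r\<close>
  of the volume element, satisfies \<open>E' \<le> K E\<close>: the pressure and transport terms vanish by the flux lemma.\<close>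

lemma axisymmetric_euler_unique:
  fixes U V :: "real \<Rightarrow> real ^ 3 \<Rightarrow> real ^ 3"
  assumes U: "euler_equations {0..t} U U\<^sub>t U\<^sub>x p p\<^sub>x" and V: "euler_equations {0..t} V V\<^sub>t V\<^sub>x q q\<^sub>x"
    and axi: "\<And>s. s \<in> {0..t} \<Longrightarrow> axisymmetric_field (U s) (a s) (b s) (c s)"
      "\<And>s. s \<in> {0..t} \<Longrightarrow> axisymmetric_field (V s) (a' s) (b' s) (c' s)"
      "\<And>s. s \<in> {0..t} \<Longrightarrow> axisymmetric_function (p s) (P s)"
      "\<And>s. s \<in> {0..t} \<Longrightarrow> axisymmetric_function (q s) (Q s)"
    and init: "\<And>r z. r \<in> {0..1} \<Longrightarrow> z \<in> {- pi..pi} \<Longrightarrow> U 0 (cyl_point r 0 z) = V 0 (cyl_point r 0 z)"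
    and t: "t \<ge> 0" and r: "r \<in> {0..1}" and z: "z \<in> {- pi..pi}"
  shows "U t (cyl_point r 0 z) = V t (cyl_point r 0 z)"
proof -
  define R where "R = cbox (0, - pi) (1::real, pi)"
  have R: "R = {0..1} \<times> {- pi..pi}"
    by (simp add: R_def cbox_Pair_eq)
  define x where "x \<rho> = cyl_point (fst \<rho>) 0 (snd \<rho>)" for \<rho> :: "real \<times> real"
  have x: "x \<rho> \<in> cylinder" if "\<rho> \<in> R" for \<rho>
    using that by (auto simp: x_def R)
  have contx: "continuous_on A x" for A
    unfolding x_def by (intro continuous_intros)
  define w where "w s y = U s y - V s y" for s y
  define w\<^sub>x where "w\<^sub>x j s y = U\<^sub>x j s y - V\<^sub>x j s y" for j s y
  define w\<^sub>t where "w\<^sub>t s y = U\<^sub>t s y - V\<^sub>t s y" for s y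
  define E where "E s = integral R (\<lambda>\<rho>. fst \<rho> * (w s (x \<rho>) \<bullet> w s (x \<rho>)))" for s
  define S where "S s y = (\<Sum>j\<in>UNIV. w s y $ j * (w s y \<bullet> V\<^sub>x j s y))" for s y
  note U' = spacetime_partials_onD[OF euler_equationsD(1)[OF U]]
  note V' = spacetime_partials_onD[OF euler_equationsD(1)[OF V]]
  have slice: "continuous_on ({0..t} \<times> R) (\<lambda>\<sigma>. g (fst \<sigma>) (x (snd \<sigma>)))"
    if "continuous_on ({0..t} \<times> cylinder) (\<lambda>(s, y). g s y)" for g :: "real \<Rightarrow> real ^ 3 \<Rightarrow> 'z::topological_space"
    using that by (rule continuous_on_case_prod)
      (auto intro!: continuous_intros continuous_on_compose2[OF contx] x)
  have cont_w: "continuous_on ({0..t} \<times> R) (\<lambda>\<sigma>. w (fst \<sigma>) (x (snd \<sigma>)))"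
    and cont_wt: "continuous_on ({0..t} \<times> R) (\<lambda>\<sigma>. w\<^sub>t (fst \<sigma>) (x (snd \<sigma>)))"
    unfolding w_def w\<^sub>t_def by (intro continuous_intros slice U'(3,4) V'(3,4))+
  have cont_w_R: "continuous_on R (\<lambda>\<rho>. w s (x \<rho>))" if "s \<in> {0..t}" for s
    by (rule continuous_on_case_prod[where f = "\<lambda>s \<rho>. w s (x \<rho>)" and g = "\<lambda>\<rho>. s" and h = "\<lambda>\<rho>. \<rho>"
        and S = "{0..t} \<times> R"]) (use that cont_w in \<open>auto simp: case_prod_unfold\<close>)
  have cont_Vx_R: "continuous_on R (\<lambda>\<rho>. V\<^sub>x j s (x \<rho>))" if "s \<in> {0..t}" for s j
    by (rule continuous_on_case_prod[where f = "\<lambda>s \<rho>. V\<^sub>x j s (x \<rho>)" and g = "\<lambda>\<rho>. s" and h = "\<lambda>\<rho>. \<rho>"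
        and S = "{0..t} \<times> R"]) (use that slice[OF V'(5)] in \<open>auto simp: case_prod_unfold\<close>)
  have "\<exists>B. \<forall>s\<in>{0..t}. \<forall>\<rho>\<in>R. norm (V\<^sub>x j s (x \<rho>)) \<le> B" for j
  proof -
    have "compact ({0..t} \<times> R)"
      by (auto simp: R_def intro: compact_Times)
    then have "bounded ((\<lambda>\<sigma>. V\<^sub>x j (fst \<sigma>) (x (snd \<sigma>))) ` ({0..t} \<times> R))"
      by (intro compact_imp_bounded compact_continuous_image slice V'(5))
    then show ?thesis
      by (force simp: bounded_iff)
  qed
  then obtain B where B: "\<And>j s \<rho>. s \<in> {0..t} \<Longrightarrow> \<rho> \<in> R \<Longrightarrow> norm (V\<^sub>x j s (x \<rho>)) \<le> B j"
    by metis
  define K where "K = (\<Sum>j\<in>UNIV. B j)"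
  have S_le: "\<bar>S s (x \<rho>)\<bar> \<le> K * (w s (x \<rho>) \<bullet> w s (x \<rho>))"
    if s: "s \<in> {0..t}" and \<rho>: "\<rho> \<in> R" for s \<rho>
  proof -
    have "\<bar>S s (x \<rho>)\<bar> \<le> (\<Sum>j\<in>UNIV. \<bar>w s (x \<rho>) $ j * (w s (x \<rho>) \<bullet> V\<^sub>x j s (x \<rho>))\<bar>)"
      unfolding S_def by (rule sum_abs)
    also have "\<dots> \<le> (\<Sum>j\<in>UNIV. B j * (w s (x \<rho>) \<bullet> w s (x \<rho>)))"
    proof (rule sum_mono)
      fix j
      have "\<bar>w s (x \<rho>) $ j\<bar> * \<bar>w s (x \<rho>) \<bullet> V\<^sub>x j s (x \<rho>)\<bar>
          \<le> norm (w s (x \<rho>)) * (norm (w s (x \<rho>)) * norm (V\<^sub>x j s (x \<rho>)))"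
        by (intro mult_mono component_le_norm_cart Cauchy_Schwarz_ineq2) auto
      also have "\<dots> \<le> norm (w s (x \<rho>)) * (norm (w s (x \<rho>)) * B j)"
        using B[OF s \<rho>] by (intro mult_left_mono) auto
      finally show "\<bar>w s (x \<rho>) $ j * (w s (x \<rho>) \<bullet> V\<^sub>x j s (x \<rho>))\<bar> \<le> B j * (w s (x \<rho>) \<bullet> w s (x \<rho>))"
        by (simp add: abs_mult dot_square_norm power2_eq_square ac_simps)
    qed
    finally show ?thesis
      by (simp add: K_def sum_distrib_right)
  qed
  have E': "(E has_real_derivative integral R (\<lambda>\<rho>. fst \<rho> * (2 * (w s (x \<rho>) \<bullet> w\<^sub>t s (x \<rho>))))) (at s within {0..t})"
    if s: "s \<in> {0..t}" for s
    unfolding E_def R_def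
  proof (rule leibniz_rule_field_derivative)
    fix s \<rho> assume s: "s \<in> {0..t}" and "\<rho> \<in> cbox (0, - pi) (1::real, pi)"
    then have \<rho>: "x \<rho> \<in> cylinder"
      by (auto simp: R_def[symmetric] intro: x)
    have "((\<lambda>s. w s (x \<rho>)) has_vector_derivative w\<^sub>t s (x \<rho>)) (at s within {0..t})"
      unfolding w_def w\<^sub>t_def using U'(2)[OF s \<rho>] V'(2)[OF s \<rho>] by (rule has_vector_derivative_diff)
    then show "((\<lambda>s. fst \<rho> * (w s (x \<rho>) \<bullet> w s (x \<rho>))) has_real_derivative
        fst \<rho> * (2 * (w s (x \<rho>) \<bullet> w\<^sub>t s (x \<rho>)))) (at s within {0..t})"
      unfolding has_vector_derivative_def has_field_derivative_def
      by (auto intro!: derivative_eq_intros simp: inner_commute algebra_simps fun_eq_iff)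
  next
    fix s assume "s \<in> {0..t}"
    then show "(\<lambda>\<rho>. fst \<rho> * (w s (x \<rho>) \<bullet> w s (x \<rho>))) integrable_on cbox (0, - pi) (1, pi)"
      unfolding R_def[symmetric]
      by (auto simp: R_def intro!: integrable_continuous continuous_intros cont_w_R[unfolded R_def])
  next
    show "continuous_on ({0..t} \<times> cbox (0, - pi) (1, pi))
       (\<lambda>(s, \<rho>). fst \<rho> * (2 * (w s (x \<rho>) \<bullet> w\<^sub>t s (x \<rho>))))"
      unfolding R_def[symmetric] case_prod_unfold by (intro continuous_intros cont_w cont_wt)
  qed (use s in auto)
  have E'_eq: "integral R (\<lambda>\<rho>. fst \<rho> * (2 * (w s (x \<rho>) \<bullet> w\<^sub>t s (x \<rho>)))) = integral R (\<lambda>\<rho>. - 2 * fst \<rho> * S s (x \<rho>))"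
    if s: "s \<in> {0..t}" for s
  proof -
    define F1 where "F1 \<rho> = fst \<rho> * (\<Sum>j\<in>UNIV. w s (x \<rho>) $ j * (p\<^sub>x j s (x \<rho>) - q\<^sub>x j s (x \<rho>)))" for \<rho>
    define F2 where "F2 \<rho> = fst \<rho> * (\<Sum>j\<in>UNIV. U s (x \<rho>) $ j *
      (w\<^sub>x j s (x \<rho>) \<bullet> w s (x \<rho>) + w s (x \<rho>) \<bullet> w\<^sub>x j s (x \<rho>)))" for \<rho>
    note Us = euler_equationsD[OF U] and Vs = euler_equationsD[OF V]
    have pw: "partials_on cylinder (w s) (\<lambda>j. w\<^sub>x j s)"
      using partials_on_diff[OF Us(3)[OF s] Vs(3)[OF s]] by (simp add: w_def[abs_def] w\<^sub>x_def[abs_def])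
    note pww = partials_on_inner[OF pw pw]
    note ppq = partials_on_diff[OF Us(2)[OF s] Vs(2)[OF s]]
    have axiw: "axisymmetric_field (w s) (\<lambda>r z. a s r z - a' s r z) (\<lambda>r z. b s r z - b' s r z) (\<lambda>r z. c s r z - c' s r z)"
      using axisymmetric_field_diff[OF axi(1)[OF s] axi(2)[OF s]] by (simp add: w_def[abs_def])
    have perw: "z_periodic (w s)"
      using Us(4)[OF s] Vs(4)[OF s] by (simp add: z_periodic_def w_def)
    have "integral R F1 = 0"
      unfolding F1_def[abs_def] x_def R_def
    proof -
      have "axisymmetric_function (\<lambda>y. p s y - q s y) (\<lambda>r z. P s r z - Q s r z)"
        using axi(3,4)[OF s] by (simp add: axisymmetric_function_def)
      moreover have "z_periodic (\<lambda>y. p s y - q s y)"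
        using Us(5)[OF s] Vs(5)[OF s] by (simp add: z_periodic_def)
      moreover have "(\<Sum>j\<in>UNIV. w\<^sub>x j s y $ j) = 0" if "y \<in> cylinder" for y
        using Us(7)[OF s that] Vs(7)[OF s that] by (simp add: w\<^sub>x_def sum_subtractf)
      moreover have "w s (cyl_point 1 \<theta> z) \<bullet> e_r \<theta> = 0" for \<theta> z
        using Us(8)[OF s, of \<theta> z] Vs(8)[OF s, of \<theta> z] by (simp add: w_def inner_diff_left)
      ultimately show "integral (cbox (0, - pi) (1, pi)) (\<lambda>\<rho>. fst \<rho> * (\<Sum>j\<in>UNIV. w s (cyl_point (fst \<rho>) 0 (snd \<rho>)) $ j *
          (p\<^sub>x j s (cyl_point (fst \<rho>) 0 (snd \<rho>)) - q\<^sub>x j s (cyl_point (fst \<rho>) 0 (snd \<rho>))))) = 0"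
        using axisymmetric_flux_integral[OF pw ppq _ _ axiw _ perw] by (simp add: case_prod_unfold)
    qed
    moreover have "integral R F2 = 0"
    proof -
      have "z_periodic (\<lambda>y. w s y \<bullet> w s y)"
        using perw by (simp add: z_periodic_def)
      then show ?thesis
        using axisymmetric_flux_integral[OF Us(3)[OF s] pww Us(7)[OF s] Us(8)[OF s] axi(1)[OF s]
            axisymmetric_field_norm_square[OF axiw] Us(4)[OF s]]
        by (simp add: case_prod_unfold F2_def[abs_def] x_def R_def)
    qed
    moreover have "fst \<rho> * (2 * (w s (x \<rho>) \<bullet> w\<^sub>t s (x \<rho>))) = - 2 * fst \<rho> * S s (x \<rho>) - 2 * F1 \<rho> - F2 \<rho>"
      if "\<rho> \<in> R" for \<rho>
    proof -
      have "w\<^sub>t s (x \<rho>) = - (\<chi> j. p\<^sub>x j s (x \<rho>) - q\<^sub>x j s (x \<rho>)) - (\<Sum>j\<in>UNIV. U s (x \<rho>) $ j *\<^sub>R w\<^sub>x j s (x \<rho>))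
          - (\<Sum>j\<in>UNIV. w s (x \<rho>) $ j *\<^sub>R V\<^sub>x j s (x \<rho>))"
        unfolding w\<^sub>t_def Us(6)[OF s x[OF that]] Vs(6)[OF s x[OF that]]
        by (simp add: w\<^sub>x_def w_def vec_eq_iff sum_3 algebra_simps)
      then have "w s (x \<rho>) \<bullet> w\<^sub>t s (x \<rho>) = - (\<Sum>j\<in>UNIV. w s (x \<rho>) $ j * (p\<^sub>x j s (x \<rho>) - q\<^sub>x j s (x \<rho>)))
          - (\<Sum>j\<in>UNIV. U s (x \<rho>) $ j * (w s (x \<rho>) \<bullet> w\<^sub>x j s (x \<rho>))) - S s (x \<rho>)"
        by (simp add: inner_diff_right inner_sum_right S_def) (simp add: inner_vec_def)
      then show ?thesis
        by (simp only:) (simp add: F1_def F2_def sum_3 inner_commute algebra_simps)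
    qed
    moreover have "(\<lambda>\<rho>. - 2 * fst \<rho> * S s (x \<rho>)) integrable_on R" "F1 integrable_on R" "F2 integrable_on R"
    proof -
      have g: "continuous_on R (\<lambda>\<rho>. g (x \<rho>))" if "continuous_on cylinder g" for g :: "real ^ 3 \<Rightarrow> 'z::topological_space"
        using that contx by (rule continuous_on_compose2) (use x in auto)
      note cont = g[OF partials_onD(2)[OF pw]] g[OF partials_onD(2)[OF ppq]] g[OF partials_onD(3)[OF pw]]
        g[OF partials_onD(3)[OF Us(3)[OF s]]] cont_Vx_R[OF s]
      have "continuous_on R (\<lambda>\<rho>. - 2 * fst \<rho> * S s (x \<rho>))" "continuous_on R F1" "continuous_on R F2"
        unfolding S_def F1_def[abs_def] F2_def[abs_def] by (intro continuous_intros cont)+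
      then show "(\<lambda>\<rho>. - 2 * fst \<rho> * S s (x \<rho>)) integrable_on R" "F1 integrable_on R" "F2 integrable_on R"
        unfolding R_def by (auto intro: integrable_continuous)
    qed
    moreover have "integral R (\<lambda>\<rho>. - 2 * fst \<rho> * S s (x \<rho>) - 2 * F1 \<rho> - F2 \<rho>)
        = integral R (\<lambda>\<rho>. - 2 * fst \<rho> * S s (x \<rho>)) - 2 * integral R F1 - integral R F2"
      using calculation(4-6)
      by (intro integral_unique has_integral_diff has_integral_mult_right integrable_integral)
    ultimately show ?thesis
      by (simp cong: integral_cong)
  qed
  have E'_le: "integral R (\<lambda>\<rho>. fst \<rho> * (2 * (w s (x \<rho>) \<bullet> w\<^sub>t s (x \<rho>)))) \<le> (2 * K) * E s"
    if s: "s \<in> {0..t}" for s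
  proof -
    have "integral R (\<lambda>\<rho>. - 2 * fst \<rho> * S s (x \<rho>))
        \<le> integral R (\<lambda>\<rho>. (2 * K) * (fst \<rho> * (w s (x \<rho>) \<bullet> w s (x \<rho>))))"
      unfolding R_def
    proof (intro integral_le integrable_continuous)
      fix \<rho> assume "\<rho> \<in> cbox (0, - pi) (1::real, pi)"
      then have \<rho>: "\<rho> \<in> R" "fst \<rho> \<ge> 0"
        by (auto simp: R_def cbox_Pair_eq)
      have "- S s (x \<rho>) \<le> K * (w s (x \<rho>) \<bullet> w s (x \<rho>))"
        using S_le[OF s \<rho>(1)] by linarith
      then have "2 * fst \<rho> * - S s (x \<rho>) \<le> 2 * fst \<rho> * (K * (w s (x \<rho>) \<bullet> w s (x \<rho>)))"
        using \<rho>(2) by (intro mult_left_mono) auto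
      then show "- 2 * fst \<rho> * S s (x \<rho>) \<le> (2 * K) * (fst \<rho> * (w s (x \<rho>) \<bullet> w s (x \<rho>)))"
        by argo
    next
      show "continuous_on (cbox (0, - pi) (1, pi)) (\<lambda>\<rho>. - 2 * fst \<rho> * S s (x \<rho>))"
        unfolding R_def[symmetric] S_def by (intro continuous_intros cont_w_R[OF s] cont_Vx_R[OF s])
      show "continuous_on (cbox (0, - pi) (1, pi)) (\<lambda>\<rho>. 2 * K * (fst \<rho> * (w s (x \<rho>) \<bullet> w s (x \<rho>))))"
        unfolding R_def[symmetric] by (intro continuous_intros cont_w_R[OF s])
    qed
    then show ?thesis
      by (simp add: E'_eq[OF s] E_def)
  qed
  have cont_wt_R: "continuous_on R (\<lambda>\<rho>. fst \<rho> * (w t (x \<rho>) \<bullet> w t (x \<rho>)))"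
    using t by (intro continuous_intros cont_w_R) auto
  have "E t \<le> E 0 * exp (integral {0..t} (\<lambda>_. 2 * K))"
    by (rule gronwall_inequality[OF t E' _ E'_le]) auto
  moreover have "E 0 = 0"
    unfolding E_def using init by (subst integral_cong[where g = "\<lambda>_. 0"]) (auto simp: R x_def w_def)
  moreover have "E t \<ge> 0"
    unfolding E_def
  proof (rule integral_nonneg)
    show "(\<lambda>\<rho>. fst \<rho> * (w t (x \<rho>) \<bullet> w t (x \<rho>))) integrable_on R"
      using cont_wt_R unfolding R_def by (rule integrable_continuous)
  qed (auto simp: R)
  ultimately have "E t = 0" by simp
  then have zero: "fst \<rho> * (w t (x \<rho>) \<bullet> w t (x \<rho>)) = 0" if "\<rho> \<in> R" for \<rho>
    unfolding E_def R_def
  proof (subst (asm) integral_cbox_eq_0_iff)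
    show "continuous_on (cbox (0, - pi) (1, pi)) (\<lambda>\<rho>. fst \<rho> * (w t (x \<rho>) \<bullet> w t (x \<rho>)))"
      using cont_wt_R unfolding R_def .
  qed (use that in \<open>auto simp: R_def cbox_Pair_eq box_ne_empty Basis_prod_def\<close>)
  have pos: "w t (cyl_point r 0 z) = 0" if "r \<in> {0<..1}" for r
    using zero[of "(r, z)"] that z by (auto simp: R x_def)
  have "w t (cyl_point r 0 z) = 0"
  proof (cases "r = 0")
    case True
    have "continuous_on {0..1} (\<lambda>r. w t (x (r, z)))"
      by (rule continuous_on_compose2[OF cont_w_R[of t], of _ "\<lambda>r. (r, z)"])
        (use t z in \<open>auto simp: R intro!: continuous_intros\<close>)
    then have "continuous_on {0..1} (\<lambda>r. w t (cyl_point r 0 z))"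
      by (simp add: x_def)
    moreover have "closure {0<..1} = {0..1::real}"
      by simp
    ultimately show ?thesis
      using continuous_constant_on_closure[of "{0<..1}" "\<lambda>r. w t (cyl_point r 0 z)" 0 r] pos r by auto
  qed (use pos r in auto)
  then show ?thesis
    by (simp add: w_def)
qed

subsection \<open>Reflection symmetry\<close>

definition reflect :: "(3 \<Rightarrow> real) \<Rightarrow> real ^ 3 \<Rightarrow> real ^ 3" where
  "reflect \<sigma> x = (\<chi> j. \<sigma> j * x $ j)"

lemma reflect_nth [simp]: "reflect \<sigma> x $ j = \<sigma> j * x $ j"
  by (simp add: reflect_def)

lemma bounded_linear_reflect: "bounded_linear (reflect \<sigma>)"
  by (intro linear_conv_bounded_linear[THEN iffD1] linearI) (auto simp: vec_eq_iff algebra_simps)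

lemma reflect_in_cylinder:
  assumes "\<And>j. (\<sigma> j)\<^sup>2 = 1" "x \<in> cylinder"
  shows "reflect \<sigma> x \<in> cylinder"
  using assms by (simp add: cylinder_def power_mult_distrib)

lemma partials_on_reflect:
  assumes \<sigma>: "\<And>j. (\<sigma> j)\<^sup>2 = 1" and f: "partials_on cylinder f f'"
  shows "partials_on cylinder (\<lambda>x. f (reflect \<sigma> x)) (\<lambda>j x. \<sigma> j *\<^sub>R f' j (reflect \<sigma> x))"
  unfolding partials_on_def
proof (intro conjI ballI allI)
  fix x assume x: "x \<in> cylinder"
  have "(f has_derivative (\<lambda>h. \<Sum>j\<in>UNIV. h $ j *\<^sub>R f' j (reflect \<sigma> x)))
      (at (reflect \<sigma> x) within reflect \<sigma> ` cylinder)"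
    by (rule has_derivative_subset[OF partials_onD(1)[OF f]]) (use x \<sigma> in \<open>auto intro: reflect_in_cylinder\<close>)
  from has_derivative_in_compose[OF bounded_linear_imp_has_derivative[OF bounded_linear_reflect] this]
  show "((\<lambda>x. f (reflect \<sigma> x)) has_derivative
      (\<lambda>h. \<Sum>j\<in>UNIV. h $ j *\<^sub>R \<sigma> j *\<^sub>R f' j (reflect \<sigma> x))) (at x within cylinder)"
    by (simp add: mult.commute)
next
  fix j
  have "continuous_on cylinder (\<lambda>x. f' j (reflect \<sigma> x))"
    by (rule continuous_on_compose2[OF partials_onD(2)[OF f]])
      (use \<sigma> in \<open>auto intro: reflect_in_cylinder linear_continuous_on bounded_linear_reflect\<close>)
  then show "continuous_on cylinder (\<lambda>x. \<sigma> j *\<^sub>R f' j (reflect \<sigma> x))"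
    by (intro continuous_intros)
qed

lemma spacetime_partials_on_reflect:
  assumes \<sigma>: "\<And>j. (\<sigma> j)\<^sup>2 = 1" and U: "spacetime_partials_on I cylinder U U\<^sub>t U\<^sub>x"
  shows "spacetime_partials_on I cylinder (\<lambda>t x. reflect \<sigma> (U t (reflect \<sigma> x)))
    (\<lambda>t x. reflect \<sigma> (U\<^sub>t t (reflect \<sigma> x))) (\<lambda>j t x. \<sigma> j *\<^sub>R reflect \<sigma> (U\<^sub>x j t (reflect \<sigma> x)))"
  unfolding spacetime_partials_on_def
proof (intro conjI ballI allI)
  note bl = bounded_linear_reflect[of \<sigma>]
  fix t x assume t: "t \<in> I" and x: "x \<in> cylinder"
  define L where "L = (\<lambda>(s::real, y). (s, reflect \<sigma> y))"
  have L: "bounded_linear L"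
    unfolding L_def case_prod_unfold
    by (intro bounded_linear_Pair bounded_linear_fst bounded_linear_compose[OF bl] bounded_linear_snd)
  have rx: "reflect \<sigma> x \<in> cylinder"
    using \<sigma> x by (rule reflect_in_cylinder)
  have "L ` (I \<times> cylinder) \<subseteq> I \<times> cylinder"
    using \<sigma> by (auto simp: L_def intro: reflect_in_cylinder)
  moreover have "((\<lambda>(t, x). U t x) has_derivative (\<lambda>(s, h). s *\<^sub>R U\<^sub>t t (reflect \<sigma> x) +
      (\<Sum>j\<in>UNIV. h $ j *\<^sub>R U\<^sub>x j t (reflect \<sigma> x)))) (at (t, reflect \<sigma> x) within I \<times> cylinder)"
    using U t rx unfolding spacetime_partials_on_def by blast
  ultimately have "((\<lambda>(t, x). U t x) has_derivative (\<lambda>(s, h). s *\<^sub>R U\<^sub>t t (reflect \<sigma> x) +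
      (\<Sum>j\<in>UNIV. h $ j *\<^sub>R U\<^sub>x j t (reflect \<sigma> x)))) (at (L (t, x)) within L ` (I \<times> cylinder))"
    by (auto simp: L_def intro: has_derivative_subset)
  from has_derivative_in_compose[OF bounded_linear_imp_has_derivative[OF L] this]
  have "((\<lambda>p. reflect \<sigma> (case L p of (t, x) \<Rightarrow> U t x)) has_derivative (\<lambda>p. reflect \<sigma> (case L p of (s, h) \<Rightarrow>
      s *\<^sub>R U\<^sub>t t (reflect \<sigma> x) + (\<Sum>j\<in>UNIV. h $ j *\<^sub>R U\<^sub>x j t (reflect \<sigma> x))))) (at (t, x) within I \<times> cylinder)"
    by (rule bounded_linear.has_derivative[OF bl])
  then show "((\<lambda>(t, x). reflect \<sigma> (U t (reflect \<sigma> x))) has_derivative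
      (\<lambda>(s, h). s *\<^sub>R reflect \<sigma> (U\<^sub>t t (reflect \<sigma> x)) +
        (\<Sum>j\<in>UNIV. h $ j *\<^sub>R \<sigma> j *\<^sub>R reflect \<sigma> (U\<^sub>x j t (reflect \<sigma> x))))) (at (t, x) within I \<times> cylinder)"
    by (rule has_derivative_eq_rhs[THEN has_derivative_transform[rotated -1]])
      (auto simp: L_def t x fun_eq_iff vec_eq_iff sum_3 algebra_simps)
next
  note bl = bounded_linear_reflect[of \<sigma>]
  have *: "continuous_on (I \<times> cylinder) (\<lambda>(t, x). reflect \<sigma> (f t (reflect \<sigma> x)))"
    if "continuous_on (I \<times> cylinder) (\<lambda>(t, x). f t x)" for f
    unfolding case_prod_unfold
    by (intro bounded_linear.continuous_on[OF bl] continuous_on_case_prod[OF that])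
      (use \<sigma> in \<open>auto intro!: reflect_in_cylinder continuous_intros bounded_linear.continuous_on[OF bl]\<close>)
  show "continuous_on (I \<times> cylinder) (\<lambda>(t, x). reflect \<sigma> (U\<^sub>t t (reflect \<sigma> x)))"
    by (rule *[OF spacetime_partials_onD(4)[OF U]])
  show "continuous_on (I \<times> cylinder) (\<lambda>(t, x). \<sigma> j *\<^sub>R reflect \<sigma> (U\<^sub>x j t (reflect \<sigma> x)))" for j
    using *[OF spacetime_partials_onD(5)[OF U, of j]]
    by (auto simp: case_prod_unfold intro!: continuous_intros)
qed

text \<open>The sign \<open>\<epsilon>\<close> distinguishes the reflection of \<open>z\<close> (\<open>\<epsilon> = 1\<close>, preserving \<open>b\<close>) from the half turn
  about the \<open>x\<close>-axis (\<open>\<epsilon> = -1\<close>, reversing \<open>b\<close>).\<close>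

definition z_reflection :: "real \<Rightarrow> 3 \<Rightarrow> real" where
  "z_reflection \<epsilon> j = (if j = 1 then 1 else if j = 2 then \<epsilon> else - 1)"

lemma z_reflection_simps [simp]:
  "z_reflection \<epsilon> 1 = 1" "z_reflection \<epsilon> 2 = \<epsilon>" "z_reflection \<epsilon> 3 = - 1"
  by (simp_all add: z_reflection_def)

lemma sin_cos_sign:
  assumes "\<epsilon>\<^sup>2 = (1::real)"
  shows "sin (\<epsilon> * \<theta>) = \<epsilon> * sin \<theta>" "cos (\<epsilon> * \<theta>) = cos \<theta>"
  using assms by (auto simp: power2_eq_1_iff)

lemma reflect_cyl_frame:
  assumes "\<epsilon>\<^sup>2 = 1"
  shows "reflect (z_reflection \<epsilon>) (cyl_point r \<theta> z) = cyl_point r (\<epsilon> * \<theta>) (- z)"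
    and "reflect (z_reflection \<epsilon>) (e_r (\<epsilon> * \<theta>)) = e_r \<theta>"
    and "reflect (z_reflection \<epsilon>) (e_theta (\<epsilon> * \<theta>)) = \<epsilon> *\<^sub>R e_theta \<theta>"
    and "reflect (z_reflection \<epsilon>) e_z = - e_z"
  using assms by (auto simp: vec_eq_iff forall_3 sin_cos_sign power2_eq_square mult.assoc[symmetric])

lemma axisymmetric_field_reflect:
  assumes \<epsilon>: "\<epsilon>\<^sup>2 = 1" and V: "axisymmetric_field V a b c"
  shows "axisymmetric_field (\<lambda>x. reflect (z_reflection \<epsilon>) (V (reflect (z_reflection \<epsilon>) x)))
     (\<lambda>r z. a r (- z)) (\<lambda>r z. \<epsilon> * b r (- z)) (\<lambda>r z. - c r (- z))"
  unfolding axisymmetric_field_def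
proof (intro ballI allI)
  fix r :: real and \<theta> z assume r: "r \<in> {0..1}"
  interpret bounded_linear "reflect (z_reflection \<epsilon>)" by (rule bounded_linear_reflect)
  have "V (reflect (z_reflection \<epsilon>) (cyl_point r \<theta> z)) =
      a r (- z) *\<^sub>R e_r (\<epsilon> * \<theta>) + b r (- z) *\<^sub>R e_theta (\<epsilon> * \<theta>) + c r (- z) *\<^sub>R e_z"
    using V r by (simp add: axisymmetric_field_def reflect_cyl_frame(1)[OF \<epsilon>])
  then show "reflect (z_reflection \<epsilon>) (V (reflect (z_reflection \<epsilon>) (cyl_point r \<theta> z))) =
      a r (- z) *\<^sub>R e_r \<theta> + (\<epsilon> * b r (- z)) *\<^sub>R e_theta \<theta> + (- c r (- z)) *\<^sub>R e_z"
    by (simp add: add scaleR reflect_cyl_frame[OF \<epsilon>] mult.commute)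
qed

lemma axisymmetric_function_reflect:
  assumes "\<epsilon>\<^sup>2 = 1" "axisymmetric_function f F"
  shows "axisymmetric_function (\<lambda>x. f (reflect (z_reflection \<epsilon>) x)) (\<lambda>r z. F r (- z))"
  using assms by (simp add: axisymmetric_function_def reflect_cyl_frame)

lemma z_periodic_reflect:
  assumes \<epsilon>: "\<epsilon>\<^sup>2 = 1" and f: "z_periodic f"
  shows "z_periodic (\<lambda>x. f (reflect (z_reflection \<epsilon>) x))"
  unfolding z_periodic_def
proof
  fix x assume x: "x \<in> cylinder"
  define y where "y = reflect (z_reflection \<epsilon>) (x + vector [0, 0, 2 * pi])"
  have "y \<in> cylinder"
    using x \<epsilon> by (simp add: y_def cylinder_def power_mult_distrib)
  moreover have "reflect (z_reflection \<epsilon>) x = y + vector [0, 0, 2 * pi]"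
    by (simp add: y_def vec_eq_iff forall_3)
  ultimately show "f (reflect (z_reflection \<epsilon>) (x + vector [0, 0, 2 * pi])) = f (reflect (z_reflection \<epsilon>) x)"
    using f by (simp add: z_periodic_def y_def)
qed

lemma euler_equations_reflect:
  assumes \<epsilon>: "\<epsilon>\<^sup>2 = 1" and U: "euler_equations I U U\<^sub>t U\<^sub>x p p\<^sub>x"
  defines "\<rho> \<equiv> reflect (z_reflection \<epsilon>)"
  shows "euler_equations I (\<lambda>t x. \<rho> (U t (\<rho> x))) (\<lambda>t x. \<rho> (U\<^sub>t t (\<rho> x)))
     (\<lambda>j t x. z_reflection \<epsilon> j *\<^sub>R \<rho> (U\<^sub>x j t (\<rho> x))) (\<lambda>t x. p t (\<rho> x)) (\<lambda>j t x. z_reflection \<epsilon> j *\<^sub>R p\<^sub>x j t (\<rho> x))"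
proof -
  have sq: "(z_reflection \<epsilon> j)\<^sup>2 = 1" for j
    using \<epsilon> by (simp add: z_reflection_def)
  have sq': "z_reflection \<epsilon> j * (z_reflection \<epsilon> j * y) = y" for j y
    using sq[of j] by (simp add: power2_eq_square mult.assoc[symmetric])
  have cyl: "\<rho> x \<in> cylinder" if "x \<in> cylinder" for x
    unfolding \<rho>_def using sq that by (rule reflect_in_cylinder)
  note E = euler_equationsD[OF U]
  show ?thesis
    unfolding euler_equations_def
  proof (intro conjI ballI allI)
    show "spacetime_partials_on I cylinder (\<lambda>t x. \<rho> (U t (\<rho> x))) (\<lambda>t x. \<rho> (U\<^sub>t t (\<rho> x)))
       (\<lambda>j t x. z_reflection \<epsilon> j *\<^sub>R \<rho> (U\<^sub>x j t (\<rho> x)))"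
      unfolding \<rho>_def by (intro spacetime_partials_on_reflect sq E(1))
  next
    fix t assume t: "t \<in> I"
    show "partials_on cylinder (\<lambda>x. p t (\<rho> x)) (\<lambda>j x. z_reflection \<epsilon> j *\<^sub>R p\<^sub>x j t (\<rho> x))"
      unfolding \<rho>_def by (intro partials_on_reflect sq E(2)[OF t])
    show "z_periodic (\<lambda>x. p t (\<rho> x))"
      unfolding \<rho>_def by (intro z_periodic_reflect \<epsilon> E(5)[OF t])
    show "z_periodic (\<lambda>x. \<rho> (U t (\<rho> x)))"
      using z_periodic_reflect[OF \<epsilon> E(4)[OF t]] by (simp add: \<rho>_def z_periodic_def)
    fix x :: "real ^ 3" assume x: "x \<in> cylinder"
    show "\<rho> (U\<^sub>t t (\<rho> x)) = - (\<chi> j. z_reflection \<epsilon> j *\<^sub>R p\<^sub>x j t (\<rho> x)) -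
        (\<Sum>j\<in>UNIV. \<rho> (U t (\<rho> x)) $ j *\<^sub>R z_reflection \<epsilon> j *\<^sub>R \<rho> (U\<^sub>x j t (\<rho> x)))"
      unfolding E(6)[OF t cyl[OF x]]
      by (simp add: \<rho>_def sq' vec_eq_iff sum_distrib_left right_diff_distrib ac_simps)
    show "(\<Sum>j\<in>UNIV. (z_reflection \<epsilon> j *\<^sub>R \<rho> (U\<^sub>x j t (\<rho> x))) $ j) = 0"
      using E(7)[OF t cyl[OF x]] by (simp add: \<rho>_def sq')
  next
    fix t \<theta> z assume t: "t \<in> I"
    have "\<rho> (U t (\<rho> (cyl_point 1 \<theta> z))) \<bullet> e_r \<theta> = U t (cyl_point 1 (\<epsilon> * \<theta>) (- z)) \<bullet> \<rho> (e_r \<theta>)"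
      unfolding \<rho>_def reflect_cyl_frame(1)[OF \<epsilon>] by (simp add: inner_vec_def sum_3)
    also have "\<rho> (e_r \<theta>) = e_r (\<epsilon> * \<theta>)"
      by (simp add: \<rho>_def vec_eq_iff forall_3 sin_cos_sign[OF \<epsilon>])
    finally show "\<rho> (U t (\<rho> (cyl_point 1 \<theta> z))) \<bullet> e_r \<theta> = 0"
      using E(8)[OF t] by simp
  qed
qed

lemma axial_velocity_zero_on_symmetry_plane:
  assumes U: "euler_equations I U U\<^sub>t U\<^sub>x p p\<^sub>x" and I: "{0..t} \<subseteq> I" "0 \<le> t"
    and axi: "\<And>s. s \<in> I \<Longrightarrow> axisymmetric_field (U s) (a s) (b s) (c s)"
      "\<And>s. s \<in> I \<Longrightarrow> axisymmetric_function (p s) (P s)"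
    and init: "\<And>x. x \<in> cylinder \<Longrightarrow> U 0 x = U0 x" "axisymmetric_field U0 a0 b0 c0"
    and sym: "odd_in_z c0" "even_in_z a0" "even_in_z b0 \<or> odd_in_z b0"
    and r: "r \<in> {0..1}"
  shows "c t r 0 = 0"
proof -
  define \<epsilon> :: real where "\<epsilon> = (if even_in_z b0 then 1 else - 1)"
  have \<epsilon>: "\<epsilon>\<^sup>2 = 1" by (simp add: \<epsilon>_def)
  define \<rho> where "\<rho> = reflect (z_reflection \<epsilon>)"
  have "U t (cyl_point r 0 0) = \<rho> (U t (\<rho> (cyl_point r 0 0)))"
    unfolding \<rho>_def
  proof (rule axisymmetric_euler_unique[where V = "\<lambda>t x. reflect (z_reflection \<epsilon>) (U t (reflect (z_reflection \<epsilon>) x))"])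
    show U': "euler_equations {0..t} U U\<^sub>t U\<^sub>x p p\<^sub>x"
      using euler_equations_subset[OF U I(1)] .
    from euler_equations_reflect[OF \<epsilon> this]
    show "euler_equations {0..t} (\<lambda>t x. reflect (z_reflection \<epsilon>) (U t (reflect (z_reflection \<epsilon>) x)))
      (\<lambda>t x. reflect (z_reflection \<epsilon>) (U\<^sub>t t (reflect (z_reflection \<epsilon>) x)))
      (\<lambda>j t x. z_reflection \<epsilon> j *\<^sub>R reflect (z_reflection \<epsilon>) (U\<^sub>x j t (reflect (z_reflection \<epsilon>) x)))
      (\<lambda>t x. p t (reflect (z_reflection \<epsilon>) x)) (\<lambda>j t x. z_reflection \<epsilon> j *\<^sub>R p\<^sub>x j t (reflect (z_reflection \<epsilon>) x))" .
    fix s assume "s \<in> {0..t}"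
    with I have s: "s \<in> I" by auto
    show "axisymmetric_field (U s) (a s) (b s) (c s)" "axisymmetric_function (p s) (P s)"
      using axi s by auto
    show "axisymmetric_field (\<lambda>x. reflect (z_reflection \<epsilon>) (U s (reflect (z_reflection \<epsilon>) x)))
      (\<lambda>r z. a s r (- z)) (\<lambda>r z. \<epsilon> * b s r (- z)) (\<lambda>r z. - c s r (- z))"
      using axi(1)[OF s] by (rule axisymmetric_field_reflect[OF \<epsilon>])
    show "axisymmetric_function (\<lambda>x. p s (reflect (z_reflection \<epsilon>) x)) (\<lambda>r z. P s r (- z))"
      using axi(2)[OF s] by (rule axisymmetric_function_reflect[OF \<epsilon>])
  next
    fix r z :: real assume r: "r \<in> {0..1}" and z: "z \<in> {- pi..pi}"
    have "reflect (z_reflection \<epsilon>) (U 0 (reflect (z_reflection \<epsilon>) (cyl_point r 0 z))) =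
        reflect (z_reflection \<epsilon>) (U0 (reflect (z_reflection \<epsilon>) (cyl_point r 0 z)))"
      using r by (simp add: init(1) reflect_cyl_frame(1)[OF \<epsilon>])
    also have "\<dots> = a0 r (- z) *\<^sub>R e_r 0 + (\<epsilon> * b0 r (- z)) *\<^sub>R e_theta 0 + (- c0 r (- z)) *\<^sub>R e_z"
      using axisymmetric_field_reflect[OF \<epsilon> init(2)] r by (simp add: axisymmetric_field_def)
    also have "\<dots> = a0 r z *\<^sub>R e_r 0 + b0 r z *\<^sub>R e_theta 0 + c0 r z *\<^sub>R e_z"
    proof -
      have "a0 r (- z) = a0 r z" "- c0 r (- z) = c0 r z"
        using sym(1,2) r z by (simp_all add: even_in_z_def odd_in_z_def)
      moreover have "\<epsilon> * b0 r (- z) = b0 r z"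
        using sym(3) r z by (auto simp: \<epsilon>_def even_in_z_def odd_in_z_def)
      ultimately show ?thesis by simp
    qed
    also have "\<dots> = U 0 (cyl_point r 0 z)"
      using init r by (simp add: axisymmetric_field_def)
    finally show "U 0 (cyl_point r 0 z) = reflect (z_reflection \<epsilon>) (U 0 (reflect (z_reflection \<epsilon>) (cyl_point r 0 z)))"
      by simp
  qed (use I r in auto)
  then have "U t (cyl_point r 0 0) $ 3 = - U t (cyl_point r 0 0) $ 3"
    using reflect_cyl_frame(1)[OF \<epsilon>, of r 0 0] by (metis \<rho>_def minus_zero mult_minus1 mult_zero_right
        reflect_nth z_reflection_simps(3))
  moreover have "t \<in> I" using I by auto
  ultimately show ?thesis
    using axi(1)[of t] r by (simp add: axisymmetric_field_def)
qed

subsection \<open>Blow-up of the axial strain\<close>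

lemma axisymmetric_field_axis:
  assumes "axisymmetric_field V a b c"
  shows "V (cyl_point 0 0 z) $ 1 = 0" and "V (cyl_point 0 0 z) $ 2 = 0"
proof -
  have ax: "V (cyl_point 0 \<theta> z) = a 0 z *\<^sub>R e_r \<theta> + b 0 z *\<^sub>R e_theta \<theta> + c 0 z *\<^sub>R e_z" for \<theta>
    using assms by (simp add: axisymmetric_field_def)
  note V = ax[of 0]
  note ax
  moreover have "cyl_point 0 pi z = cyl_point 0 0 z"
    by (simp add: cyl_point_def)
  ultimately have "a 0 z *\<^sub>R e_r pi + b 0 z *\<^sub>R e_theta pi = a 0 z *\<^sub>R e_r 0 + b 0 z *\<^sub>R e_theta 0"
    by (metis add_right_cancel)
  then have "a 0 z = 0" "b 0 z = 0"
    by (simp_all add: vec_eq_iff forall_3)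
  with V show "V (cyl_point 0 0 z) $ 1 = 0" "V (cyl_point 0 0 z) $ 2 = 0"
    by simp_all
qed

text \<open>Only \<open>r \<in> {0, 1}\<close> makes the radial and angular advection of \<open>c\<close> vanish; on the plane \<open>z = 0\<close> the
  \<open>z\<close>-derivative of the third momentum equation is then the Riccati equation for \<open>c\<^sub>z\<close>.\<close>

lemma axial_strain_riccati:
  assumes sol: "euler_solution U0 \<infinity> U p"
    and axi: "\<And>t. t \<ge> 0 \<Longrightarrow> axisymmetric_field (U t) (a t) (b t) (c t)"
      "\<And>t. t \<ge> 0 \<Longrightarrow> axisymmetric_function (p t) (P t)"
    and init: "axisymmetric_field U0 a0 b0 c0"
    and sym: "odd_in_z c0" "even_in_z a0" "even_in_z b0 \<or> odd_in_z b0"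
    and r: "r \<in> {0, 1}" and t: "t \<ge> 0"
  shows "((\<lambda>t. deriv (\<lambda>z. c t r z) 0) has_real_derivative
      - (deriv (\<lambda>z. c t r z) 0)\<^sup>2 - (deriv ^^ 2) (\<lambda>z. P t r z) 0) (at t within {0..})"
proof -
  have times: "times_before \<infinity> = {0..}"
    by (auto simp: times_before_def)
  obtain U\<^sub>t U\<^sub>x p\<^sub>x where E: "euler_equations {0..} U U\<^sub>t U\<^sub>x p p\<^sub>x"
    and C1: "Ck_on 1 ({0..} \<times> cylinder) (\<lambda>(t, x). U\<^sub>t t x)" "Ck_on 1 ({0..} \<times> cylinder) (\<lambda>(t, x). U\<^sub>x 3 t x)"
    using euler_solution_equations[OF sol] unfolding times by metis
  obtain U\<^sub>t\<^sub>t U\<^sub>t\<^sub>x where Ut: "spacetime_partials_on {0..} cylinder U\<^sub>t U\<^sub>t\<^sub>t U\<^sub>t\<^sub>x"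
    using C1(1) Ck_on_spacetime_partials unfolding One_nat_def by metis
  obtain U\<^sub>z\<^sub>t U\<^sub>z\<^sub>x where Uz: "spacetime_partials_on {0..} cylinder (U\<^sub>x 3) U\<^sub>z\<^sub>t U\<^sub>z\<^sub>x"
    using C1(2) Ck_on_spacetime_partials unfolding One_nat_def by metis
  note EU = euler_equationsD[OF E]
  note U' = spacetime_partials_onD[OF EU(1)] and Ut' = spacetime_partials_onD[OF Ut]
    and Uz' = spacetime_partials_onD[OF Uz]
  define x where "x z = cyl_point r 0 z" for z
  have r01: "r \<in> {0..1}" using r by auto
  have x: "x z \<in> cylinder" for z
    using r01 by (simp add: x_def)
  have c_eq: "U s (x z) $ 3 = c s r z" if "s \<ge> 0" for s z
    using axi(1)[OF that] r01 by (simp add: axisymmetric_field_def x_def)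
  have dz: "((\<lambda>z. f (x z) $ 3) has_real_derivative f' 3 (x z) $ 3) (at z)"
    if "partials_on cylinder f f'" for f :: "real ^ 3 \<Rightarrow> real ^ 3" and f' z
    using bounded_linear.has_vector_derivative[OF bounded_linear_vec_nth
        has_vector_derivative_cyl_coordinate(3)[OF that r01]]
    by (simp add: x_def has_real_derivative_iff_has_vector_derivative)
  have c_z: "((\<lambda>z. c s r z) has_real_derivative U\<^sub>x 3 s (x z) $ 3) (at z)" if "s \<ge> 0" for s z
    using dz[OF U'(1)[of s], of z] that c_eq by simp
  have strain: "deriv (\<lambda>z. c s r z) 0 = U\<^sub>x 3 s (x 0) $ 3" if "s \<ge> 0" for s
    using c_z[OF that] by (rule DERIV_imp_deriv)
  have axi': "axisymmetric_field (U s) (a s) (b s) (c s)" "axisymmetric_function (p s) (P s)" if "s \<in> {0..}" for s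
    using axi that by auto
  have c0: "c t r 0 = 0"
  proof (rule axial_velocity_zero_on_symmetry_plane[OF E _ t axi' _ init sym r01])
    show "U 0 x = U0 x" if "x \<in> cylinder" for x
      using sol that by (simp add: euler_solution_def)
  qed auto
  have momentum: "p\<^sub>x 3 t (x z) = - U\<^sub>t t (x z) $ 3 - c t r z * U\<^sub>x 3 t (x z) $ 3" for z
  proof -
    have "U t (x z) $ 1 = 0" "U t (x z) $ 2 * U\<^sub>x 2 t (x z) $ 3 = 0"
    proof -
      have Ut: "axisymmetric_field (U t) (a t) (b t) (c t)"
        using axi(1) t .
      show "U t (x z) $ 1 = 0"
        using EU(8)[of t 0 z] r t axisymmetric_field_axis[OF Ut] 
        by (auto simp: x_def inner_vec_def sum_3)
      show "U t (x z) $ 2 * U\<^sub>x 2 t (x z) $ 3 = 0"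
        using r arg_cong[OF axisymmetric_field_angular[OF U'(1)[of t] Ut r01, of z], of "\<lambda>v. v $ 3"]
          axisymmetric_field_axis[OF Ut] t
        by (auto simp: x_def)
    qed
    then show ?thesis
      using arg_cong[OF EU(6)[of t, OF _ x[of z]], of "\<lambda>v. v $ 3"] t
      by (auto simp: sum_3 c_eq algebra_simps)
  qed
  have P_z: "deriv (\<lambda>z. P t r z) = (\<lambda>z. - U\<^sub>t t (x z) $ 3 - c t r z * U\<^sub>x 3 t (x z) $ 3)"
  proof
    fix z
    have "((\<lambda>z. P t r z) has_real_derivative p\<^sub>x 3 t (x z)) (at z)"
      using has_vector_derivative_cyl_coordinate(3)[OF EU(2)[of t] r01, of z UNIV] t axi(2)[OF t] r01
      by (simp add: axisymmetric_function_def x_def has_real_derivative_iff_has_vector_derivative)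
    then show "deriv (\<lambda>z. P t r z) z = - U\<^sub>t t (x z) $ 3 - c t r z * U\<^sub>x 3 t (x z) $ 3"
      unfolding momentum by (rule DERIV_imp_deriv)
  qed
  have "((\<lambda>z. - U\<^sub>t t (x z) $ 3 - c t r z * U\<^sub>x 3 t (x z) $ 3) has_real_derivative
      - U\<^sub>t\<^sub>x 3 t (x 0) $ 3 - (U\<^sub>x 3 t (x 0) $ 3)\<^sup>2) (at 0)"
    using dz[OF Ut'(1)[of t], of 0] c_z[OF t, of 0] dz[OF Uz'(1)[of t], of 0] t c0
    by (auto intro!: derivative_eq_intros simp: power2_eq_square)
  then have "deriv (deriv (\<lambda>z. P t r z)) 0 = - U\<^sub>t\<^sub>x 3 t (x 0) $ 3 - (U\<^sub>x 3 t (x 0) $ 3)\<^sup>2"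
    unfolding P_z by (rule DERIV_imp_deriv)
  then have P_zz: "(deriv ^^ 2) (\<lambda>z. P t r z) 0 = - U\<^sub>t\<^sub>x 3 t (x 0) $ 3 - (U\<^sub>x 3 t (x 0) $ 3)\<^sup>2"
    by (simp add: numeral_2_eq_2)
  have cont: "continuous_on ({0..} \<times> UNIV) (\<lambda>(s, z). f s (x z) $ 3)"
    if "continuous_on ({0..} \<times> cylinder) (\<lambda>(s, y). f s y)" for f :: "real \<Rightarrow> real ^ 3 \<Rightarrow> real ^ 3"
    unfolding case_prod_unfold
    by (intro continuous_intros continuous_on_case_prod[OF that])
      (use x in \<open>auto simp: x_def intro!: continuous_intros\<close>)
  have "((\<lambda>s. U\<^sub>x 3 s (x 0) $ 3) has_real_derivative U\<^sub>t\<^sub>x 3 t (x 0) $ 3) (at t within {0..})"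
  proof (rule has_real_derivative_mixed_partial[OF t, where \<zeta> = 0 and f = "\<lambda>s z. U s (x z) $ 3"
        and f\<^sub>t = "\<lambda>s z. U\<^sub>t s (x z) $ 3" and f\<^sub>t\<^sub>z = "\<lambda>s z. U\<^sub>t\<^sub>x 3 s (x z) $ 3"])
    fix s z :: real assume s: "s \<ge> 0"
    show "((\<lambda>s. U s (x z) $ 3) has_real_derivative U\<^sub>t s (x z) $ 3) (at s within {0..})"
      using bounded_linear.has_vector_derivative[OF bounded_linear_vec_nth U'(2)[OF _ x]] s
      by (simp add: has_real_derivative_iff_has_vector_derivative)
    show "((\<lambda>z. U\<^sub>t s (x z) $ 3) has_real_derivative U\<^sub>t\<^sub>x 3 s (x z) $ 3) (at z)"
      using dz[OF Ut'(1)] s by simp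
    show "((\<lambda>z. U s (x z) $ 3) has_real_derivative U\<^sub>x 3 s (x 0) $ 3) (at 0)"
      using dz[OF U'(1)] s by simp
  next
    show "continuous_on ({0..} \<times> UNIV) (\<lambda>(s, z). U\<^sub>t s (x z) $ 3)"
      by (rule cont[OF Ut'(3)])
    show "continuous_on ({0..} \<times> UNIV) (\<lambda>(s, z). U\<^sub>t\<^sub>x 3 s (x z) $ 3)"
      by (rule cont[OF Ut'(5)])
  qed
  then have "((\<lambda>t. deriv (\<lambda>z. c t r z) 0) has_real_derivative U\<^sub>t\<^sub>x 3 t (x 0) $ 3) (at t within {0..})"
    by (rule has_field_derivative_transform_within[where d = 1]) (simp_all add: t strain)
  then show ?thesis
    by (simp add: P_zz strain[OF t])
qed

lemma axisymmetric_blowup: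
  assumes sol: "euler_solution U0 T U p"
    and axi: "\<And>t. t \<in> times_before T \<Longrightarrow> axisymmetric_field (U t) (a t) (b t) (c t)"
      "\<And>t. t \<in> times_before T \<Longrightarrow> axisymmetric_function (p t) (P t)"
    and init: "axisymmetric_field U0 a0 b0 c0"
    and sym: "odd_in_z c0" "even_in_z a0" "even_in_z b0 \<or> odd_in_z b0"
    and r: "r \<in> {0, 1}"
    and data: "(deriv ^^ 2) (\<lambda>z. P 0 r z) 0 < 0" "deriv (\<lambda>z. c 0 r z) 0 < 0"
      "(deriv (\<lambda>z. c 0 r z) 0)\<^sup>2 + (deriv ^^ 2) (\<lambda>z. P 0 r z) 0 > 0"
    and mono: "mono_on (times_before T) (\<lambda>t. (deriv ^^ 2) (\<lambda>z. P t r z) 0)"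
  shows "T < \<infinity>"
proof (rule ccontr)
  assume "\<not> T < \<infinity>"
  then have T: "T = \<infinity>" by simp
  have times: "times_before T = {0..}"
    by (auto simp: times_before_def T)
  define w where "w t = deriv (\<lambda>z. c t r z) 0" for t
  define Q where "Q t = (deriv ^^ 2) (\<lambda>z. P t r z) 0" for t
  define k where "k = sqrt (- Q 0)"
  have k: "k > 0" "k\<^sup>2 = - Q 0"
    using data(1) by (simp_all add: k_def Q_def)
  show False
  proof (rule riccati_no_global_solution[where w = w and w' = "\<lambda>t. - (w t)\<^sup>2 - Q t" and k = k])
    fix t :: real assume t: "t \<ge> 0"
    have "axisymmetric_field (U s) (a s) (b s) (c s)" "axisymmetric_function (p s) (P s)" if "s \<ge> 0" for s
      using axi that by (auto simp: times)
    from axial_strain_riccati[OF sol[unfolded T] this init sym r t]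
    show "(w has_real_derivative - (w t)\<^sup>2 - Q t) (at t within {0..})"
      by (simp add: w_def[abs_def] Q_def)
    show "- (w t)\<^sup>2 - Q t \<le> k\<^sup>2 - (w t)\<^sup>2"
      using mono_onD[OF mono, of 0 t] t by (simp add: k(2) Q_def times)
  next
    show "k > 0" by fact
    have "k\<^sup>2 < (- w 0)\<^sup>2"
      using data(3) by (simp add: k(2) w_def Q_def)
    then have "k < - w 0"
      by (rule power2_less_imp_less) (use data(2) in \<open>simp add: w_def\<close>)
    then show "w 0 < - k" by simp
  qed
qed

theorem theorem1p3:
  fixes T :: ereal
    and U :: "real \<Rightarrow> real ^ 3 \<Rightarrow> real ^ 3" and U0 :: "real ^ 3 \<Rightarrow> real ^ 3"
    and p :: "real \<Rightarrow> real ^ 3 \<Rightarrow> real"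
    and a b c P :: "real \<Rightarrow> real \<Rightarrow> real \<Rightarrow> real"
    and a0 b0 c0 :: "real \<Rightarrow> real \<Rightarrow> real"
  assumes "maximal_euler_solution U0 T U p"
    and "\<And>t. t \<in> times_before T \<Longrightarrow> axisymmetric_field (U t) (a t) (b t) (c t)"
    and "\<And>t. t \<in> times_before T \<Longrightarrow> axisymmetric_function (p t) (P t)"
    and "axisymmetric_field U0 a0 b0 c0"
    and "odd_in_z c0" and "even_in_z a0" and "even_in_z b0 \<or> odd_in_z b0"
  shows "((deriv ^^ 2) (\<lambda>z. P 0 1 z) 0 < 0 \<and>
          deriv (\<lambda>z. c 0 1 z) 0 < 0 \<and>
          (deriv (\<lambda>z. c 0 1 z) 0)\<^sup>2 + (deriv ^^ 2) (\<lambda>z. P 0 1 z) 0 > 0 \<and>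
          mono_on (times_before T) (\<lambda>t. (deriv ^^ 2) (\<lambda>z. P t 1 z) 0)
            \<longrightarrow> T < \<infinity>) \<and>
         ((deriv ^^ 2) (\<lambda>z. P 0 0 z) 0 < 0 \<and>
          deriv (\<lambda>z. c 0 0 z) 0 < 0 \<and>
          (deriv (\<lambda>z. c 0 0 z) 0)\<^sup>2 + (deriv ^^ 2) (\<lambda>z. P 0 0 z) 0 > 0 \<and>
          mono_on (times_before T) (\<lambda>t. (deriv ^^ 2) (\<lambda>z. P t 0 z) 0)
            \<longrightarrow> T < \<infinity>)"
proof -
  have "euler_solution U0 T U p"
    using assms(1) by (simp add: maximal_euler_solution_def)
  note blowup = axisymmetric_blowup[OF this assms(2-7)]
  show ?thesis
    using blowup[of 1] blowup[of 0] by blast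
qed

end
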